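(* Let $n,r\ge2$ and let $M$ be the monoid with presentation $\langle x_1,\ldots,x_r\mid x_ix_1^{n-1}=x_1^{n}\text{ for }i=2,\ldots,r\rangle$. Then $M$ is homogeneously finitely generated, left cancellative, and every pair of elements of $M$ has a least (with respect to $\le_L$) common right multiple; consequently $\mathcal{L}:=(M,\le_L)$ is an upho lattice. Its core is $L:=\{\hat0\}\oplus r\cdot[n-1]\oplus\{\hat1\}$, the poset obtained by adjoining a minimum and a maximum to the disjoint union of $r$ chains each with $n-1$ elements, and $F(\mathcal{L};x)^{-1}=\chi^*(L;x)=1-rx+(r-1)x^n$.
   Context: A monoid is homogeneously finitely generated if it has a presentation with finitely many generators in which every relation $w=w'$ has $w,w'$ words of equal length. Left cancellative: $ab=ac$ implies $b=c$. Left divisibility: $a\le_L b$ iff $ax=b$ for some $x$; $b$ is then a right multiple of $a$. A poset $\mathcal{P}$ is finite type $\mathbb{N}$-graded if it has a minimum $\hat0$, a rank function $\rho$ with $\rho(\hat0)=0$ such that every maximal chain has the form $\hat0=x_0\lessdot x_1\lessdot\cdots$ with $\rho(x_i)=i$, and finitely many elements of each rank. An upho lattice is a finite type $\mathbb{N}$-graded lattice $\mathcal{L}$ with at least two elements such that for every $p\in\mathcal{L}$ the principal filter $\{q\ge p\}$ is isomorphic to $\mathcal{L}$. Its core is $[\hat0,s_1\vee\cdots\vee s_r]$ with $s_i$ the atoms. $F(\mathcal{L};x)=\sum_{p\in\mathcal{L}}x^{\rho(p)}$, and for a finite graded lattice $L$, $\chi^*(L;x)=\sum_{p\in L}\mu(\hat0,p)x^{\rho(p)}$.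 *)

theory Defs
  imports
    "HOL-Algebra.Divisibility"
    "HOL-Algebra.Lattice"
    "HOL-Library.Extended_Nat"
    "HOL-Computational_Algebra.Polynomial_FPS"
begin

section \<open>Monoids given by presentations\<close>

inductive_set pres_cong :: "'a set \<Rightarrow> ('a list \<times> 'a list) set \<Rightarrow> ('a list \<times> 'a list) set"
  for A :: "'a set" and R :: "('a list \<times> 'a list) set" where
  rel: "(u, v) \<in> R \<Longrightarrow> (u, v) \<in> pres_cong A R"
| refl: "u \<in> lists A \<Longrightarrow> (u, u) \<in> pres_cong A R"
| sym: "(u, v) \<in> pres_cong A R \<Longrightarrow> (v, u) \<in> pres_cong A R"
| trans: "(u, v) \<in> pres_cong A R \<Longrightarrow> (v, w) \<in> pres_cong A R \<Longrightarrow> (u, w) \<in> pres_cong A R"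
| append: "(u, u') \<in> pres_cong A R \<Longrightarrow> (v, v') \<in> pres_cong A R \<Longrightarrow>
    (u @ v, u' @ v') \<in> pres_cong A R"

text \<open>The free monoid on \<open>A\<close> modulo the congruence generated by \<open>R\<close>; meaningful for
  \<open>R \<subseteq> lists A \<times> lists A\<close>. Elements are congruence classes of words.\<close>

definition presented_monoid :: "'a set \<Rightarrow> ('a list \<times> 'a list) set \<Rightarrow> 'a list set monoid" where
  "presented_monoid A R =
    \<lparr> carrier = lists A // pres_cong A R,
      mult = (\<lambda>X Y. \<Union>u\<in>X. \<Union>v\<in>Y. pres_cong A R `` {u @ v}),
      one = pres_cong A R `` {[]} \<rparr>"

text \<open>Since the generating set is finite, taking it to consist of natural numbers loses no
  generality.\<close>

definition homogeneously_finitely_generated :: "('a, 'b) monoid_scheme \<Rightarrow> bool" where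
  "homogeneously_finitely_generated G \<longleftrightarrow>
    monoid G \<and>
    (\<exists>(A :: nat set) R. finite A \<and> R \<subseteq> lists A \<times> lists A \<and>
       (\<forall>(w, w') \<in> R. length w = length w') \<and>
       G \<cong> presented_monoid A R)"

definition left_cancellative :: "('a, 'b) monoid_scheme \<Rightarrow> bool" where
  "left_cancellative G \<longleftrightarrow>
    (\<forall>a\<in>carrier G. \<forall>b\<in>carrier G. \<forall>c\<in>carrier G. a \<otimes>\<^bsub>G\<^esub> b = a \<otimes>\<^bsub>G\<^esub> c \<longrightarrow> b = c)"

text \<open>The library's \<open>a divides\<^bsub>G\<^esub> b\<close> is left divisibility: \<open>b = a \<otimes>\<^bsub>G\<^esub> c\<close> for some \<open>c\<close>.
  Unlike the library's \<open>division_rel\<close>, the underlying equality here is genuine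
  equality, not associatedness, so antisymmetry is a nontrivial property.\<close>

definition left_divisibility_order :: "('a, 'b) monoid_scheme \<Rightarrow> 'a gorder" where
  "left_divisibility_order G = \<lparr> carrier = carrier G, eq = (=), le = (\<lambda>a b. a divides\<^bsub>G\<^esub> b) \<rparr>"

definition is_least_common_right_multiple ::
    "('a, 'b) monoid_scheme \<Rightarrow> 'a \<Rightarrow> 'a \<Rightarrow> 'a \<Rightarrow> bool" where
  "is_least_common_right_multiple G c a b \<longleftrightarrow>
    c \<in> carrier G \<and> a divides\<^bsub>G\<^esub> c \<and> b divides\<^bsub>G\<^esub> c \<and>
    (\<forall>d\<in>carrier G. a divides\<^bsub>G\<^esub> d \<and> b divides\<^bsub>G\<^esub> d \<longrightarrow> c divides\<^bsub>G\<^esub> d)"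


section \<open>Posets\<close>

definition poset_isomorphic :: "('a, 'c) gorder_scheme \<Rightarrow> ('b, 'd) gorder_scheme \<Rightarrow> bool" where
  "poset_isomorphic P Q \<longleftrightarrow>
    (\<exists>f. bij_betw f (carrier P) (carrier Q) \<and>
      (\<forall>x\<in>carrier P. \<forall>y\<in>carrier P. x \<sqsubseteq>\<^bsub>P\<^esub> y \<longleftrightarrow> f x \<sqsubseteq>\<^bsub>Q\<^esub> f y))"

definition covered_by :: "('a, 'c) gorder_scheme \<Rightarrow> 'a \<Rightarrow> 'a \<Rightarrow> bool" where
  "covered_by P x y \<longleftrightarrow> x \<in> carrier P \<and> y \<in> carrier P \<and> x \<sqsubset>\<^bsub>P\<^esub> y \<and>
    \<not> (\<exists>z\<in>carrier P. x \<sqsubset>\<^bsub>P\<^esub> z \<and> z \<sqsubset>\<^bsub>P\<^esub> y)"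

abbreviation maximal_chain :: "('a, 'c) gorder_scheme \<Rightarrow> 'a set \<Rightarrow> bool" where
  "maximal_chain P C \<equiv> pred_on.maxchain (carrier P) (le P) C"

text \<open>\<open>C\<close> is a saturated chain \<open>x 0, x 1, \<dots>\<close> with \<open>N\<close> elements (infinitely many if
  \<open>N = \<infinity>\<close>) starting at the minimum, and \<open>\<rho> (x i) = i\<close>.\<close>

definition ranked_chain ::
    "('a, 'c) gorder_scheme \<Rightarrow> ('a \<Rightarrow> nat) \<Rightarrow> enat \<Rightarrow> 'a set \<Rightarrow> bool" where
  "ranked_chain P \<rho> N C \<longleftrightarrow> 0 < N \<and>
    (\<exists>x :: nat \<Rightarrow> 'a. C = x ` {i. enat i < N} \<and> x 0 = \<bottom>\<^bsub>P\<^esub> \<and>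
      (\<forall>i. enat (Suc i) < N \<longrightarrow> covered_by P (x i) (x (Suc i))) \<and>
      (\<forall>i. enat i < N \<longrightarrow> \<rho> (x i) = i))"

definition rank_function :: "('a, 'c) gorder_scheme \<Rightarrow> ('a \<Rightarrow> nat) \<Rightarrow> bool" where
  "rank_function P \<rho> \<longleftrightarrow> \<rho> \<bottom>\<^bsub>P\<^esub> = 0 \<and>
    (\<forall>C. maximal_chain P C \<longrightarrow> (\<exists>N. ranked_chain P \<rho> N C))"

text \<open>A poset with minimum has at most one rank function on its carrier, since every element lies
  in a maximal chain, so the choice below is immaterial there.\<close>

definition rank :: "('a, 'c) gorder_scheme \<Rightarrow> 'a \<Rightarrow> nat" where
  "rank P = (SOME \<rho>. rank_function P \<rho>)"

definition finite_type_N_graded :: "('a, 'c) gorder_scheme \<Rightarrow> bool" where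
  "finite_type_N_graded P \<longleftrightarrow>
    partial_order P \<and> (\<exists>b. least P b (carrier P)) \<and>
    (\<exists>\<rho>. \<rho> \<bottom>\<^bsub>P\<^esub> = 0 \<and>
      (\<forall>C. maximal_chain P C \<longrightarrow> ranked_chain P \<rho> \<infinity> C) \<and>
      (\<forall>k. finite {p \<in> carrier P. \<rho> p = k}))"

definition finite_graded_lattice :: "('a, 'c) gorder_scheme \<Rightarrow> bool" where
  "finite_graded_lattice P \<longleftrightarrow>
    lattice P \<and> finite (carrier P) \<and> carrier P \<noteq> {} \<and> (\<exists>\<rho>. rank_function P \<rho>)"

definition principal_filter :: "'a gorder \<Rightarrow> 'a \<Rightarrow> 'a gorder" where
  "principal_filter P p = P\<lparr>carrier := {q \<in> carrier P. p \<sqsubseteq>\<^bsub>P\<^esub> q}\<rparr>"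

definition upho_lattice :: "'a gorder \<Rightarrow> bool" where
  "upho_lattice P \<longleftrightarrow>
    lattice P \<and> finite_type_N_graded P \<and>
    (\<exists>x\<in>carrier P. \<exists>y\<in>carrier P. x \<noteq> y) \<and>
    (\<forall>p\<in>carrier P. poset_isomorphic (principal_filter P p) P)"

definition atoms :: "('a, 'c) gorder_scheme \<Rightarrow> 'a set" where
  "atoms P = {s. covered_by P \<bottom>\<^bsub>P\<^esub> s}"

definition core :: "'a gorder \<Rightarrow> 'a gorder" where
  "core P = P\<lparr>carrier := at_least_at_most P \<bottom>\<^bsub>P\<^esub> (\<Squnion>\<^bsub>P\<^esub>(atoms P))\<rparr>"


section \<open>Generating functions\<close>

definition rank_gf :: "('a, 'c) gorder_scheme \<Rightarrow> rat fps" where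
  "rank_gf P = Abs_fps (\<lambda>k. of_nat (card {p \<in> carrier P. rank P p = k}))"

text \<open>The first guard is only there to make the recursion terminate; it holds for all pairs
  \<open>x \<sqsubseteq> y\<close> in a locally finite poset.\<close>

function moebius :: "('a, 'c) gorder_scheme \<Rightarrow> 'a \<Rightarrow> 'a \<Rightarrow> int" where
  "moebius P x y =
    (if partial_order P \<and> finite (at_least_at_most P x y) \<and>
        x \<in> carrier P \<and> y \<in> carrier P \<and> x \<sqsubseteq>\<^bsub>P\<^esub> y
     then if x = y then 1 else - (\<Sum>z \<in> at_least_at_most P x y - {y}. moebius P x z)
     else 0)"
  by auto
termination
proof (relation "measure (\<lambda>(P, x, y). card (at_least_at_most P x y))", goal_cases)
  case 1
  show ?case by simp
next
  case (2 P x y z)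
  then interpret partial_order P by simp
  from 2 have z: "z \<in> carrier P" "x \<sqsubseteq>\<^bsub>P\<^esub> z" "z \<sqsubseteq>\<^bsub>P\<^esub> y" "z \<noteq> y"
    by (auto simp: at_least_at_most_def)
  from 2 z have "at_least_at_most P x z \<subseteq> at_least_at_most P x y"
    by (auto simp: at_least_at_most_def intro: le_trans)
  moreover from 2 z have "y \<in> at_least_at_most P x y" "y \<notin> at_least_at_most P x z"
    by (auto simp: at_least_at_most_def intro: le_antisym)
  ultimately have "at_least_at_most P x z \<subset> at_least_at_most P x y"
    by blast
  with 2 show ?case
    by (simp add: psubset_card_mono)
qed

declare moebius.simps [simp del]

definition chi_star :: "('a, 'c) gorder_scheme \<Rightarrow> rat poly" where
  "chi_star P = (\<Sum>p\<in>carrier P. monom (of_int (moebius P \<bottom>\<^bsub>P\<^esub> p)) (rank P p))"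


section \<open>The monoid and the finite lattice\<close>

text \<open>The generator \<open>x\<^sub>i\<close> is the number \<open>i\<close>.\<close>

definition M_relations :: "nat \<Rightarrow> nat \<Rightarrow> (nat list \<times> nat list) set" where
  "M_relations n r = {(i # replicate (n - 1) 1, replicate n 1) | i. i \<in> {2..r}}"

definition M_monoid :: "nat \<Rightarrow> nat \<Rightarrow> nat list set monoid" where
  "M_monoid n r = presented_monoid {1..r} (M_relations n r)"

text \<open>\<open>disjoint_chains r k\<close> is the disjoint union of \<open>r\<close> chains with \<open>k\<close> elements each; \<open>(i, a)\<close> is
  the \<open>a\<close>-th element of the \<open>i\<close>-th chain.\<close>

definition disjoint_chains :: "nat \<Rightarrow> nat \<Rightarrow> (nat \<times> nat) gorder" where
  "disjoint_chains r k =
    \<lparr> carrier = {1..r} \<times> {1..k}, eq = (=), le = (\<lambda>(i, a) (j, b). i = j \<and> a \<le> b) \<rparr>"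

datatype 'a with_bounds = Minimum | Inner 'a | Maximum

fun with_bounds_le :: "('a \<Rightarrow> 'a \<Rightarrow> bool) \<Rightarrow> 'a with_bounds \<Rightarrow> 'a with_bounds \<Rightarrow> bool" where
  "with_bounds_le R Minimum y = True"
| "with_bounds_le R x Maximum = True"
| "with_bounds_le R (Inner a) (Inner b) = R a b"
| "with_bounds_le R x y = False"

definition adjoin_bounds :: "'a gorder \<Rightarrow> 'a with_bounds gorder" where
  "adjoin_bounds P =
    \<lparr> carrier = insert Minimum (insert Maximum (Inner ` carrier P)), eq = (=),
      le = with_bounds_le (le P) \<rparr>"

definition L_lattice :: "nat \<Rightarrow> nat \<Rightarrow> (nat \<times> nat) with_bounds gorder" where
  "L_lattice n r = adjoin_bounds (disjoint_chains r (n - 1))"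

end

theory Submission
  imports Defs
begin

text \<open>The rewrite rules \<open>x\<^sub>i x\<^sub>1\<^sup>n\<^sup>-\<^sup>1 \<rightarrow> x\<^sub>1\<^sup>n\<close> have no overlaps, and they change only the leading letter, so
  multiplying a normal form from the left by a word prepends letters and keeps the normal form as a
  suffix. This gives left cancellation, and it reduces common multiples to suffixes: words
  starting with the same letter have a least common multiple starting with that letter, and if the
  letters differ, then every common multiple is \<open>x\<^sub>1\<close> times a common multiple of the two suffixes and
  of \<open>x\<^sub>1\<^sup>n\<^sup>-\<^sup>1\<close>. The same description of normal forms yields the divisors of the join \<open>x\<^sub>1\<^sup>n\<close> of the atoms
  and, for the number \<open>N\<^sub>k\<close> of elements of rank \<open>k\<close>, the recursion
  \<open>N\<^sub>k\<^sub>+\<^sub>1 = r N\<^sub>k - (r - 1) N\<^sub>k\<^sub>+\<^sub>1\<^sub>-\<^sub>n\<close>.\<close>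


section \<open>Presented monoids\<close>

context
  fixes A :: "'a set" and R :: "('a list \<times> 'a list) set"
  assumes R: "R \<subseteq> lists A \<times> lists A"
begin

text \<open>The inclusion \<open>R\<close> in \<open>lists A \<times> lists A\<close> keeps the
  congruence among words over \<open>A\<close>; the other properties are introduction rules.\<close>

lemma equiv_pres_cong: "equiv (lists A) (pres_cong A R)"
proof (rule equivI)
  have "u \<in> lists A \<and> v \<in> lists A" if "(u, v) \<in> pres_cong A R" for u v
    using that by induction (use R in auto)
  then show "pres_cong A R \<subseteq> lists A \<times> lists A" by auto
  show "refl_on (lists A) (pres_cong A R)" by (auto simp: refl_on_def intro: pres_cong.refl)
  show "sym (pres_cong A R)" by (auto intro: symI pres_cong.sym)
  show "trans (pres_cong A R)" by (auto intro: transI pres_cong.trans)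
qed

text \<open>The product is a union over all pairs of representatives. By compatibility with
  appending, every member of the union is the same class, and the union is nonempty since
  \<open>u\<close> and \<open>v\<close> represent their own classes.\<close>

lemma presented_monoid_mult_class:
  assumes "u \<in> lists A" "v \<in> lists A"
  shows "pres_cong A R `` {u} \<otimes>\<^bsub>presented_monoid A R\<^esub> pres_cong A R `` {v} = pres_cong A R `` {u @ v}"
proof -
  let ?E = "pres_cong A R"
  have "?E `` {u' @ v'} = ?E `` {u @ v}" if "u' \<in> ?E `` {u}" "v' \<in> ?E `` {v}" for u' v'
    using equiv_class_eq[OF equiv_pres_cong pres_cong.append[of u u' A R v v']] that by simp
  then have "(\<Union>u'\<in>?E `` {u}. \<Union>v'\<in>?E `` {v}. ?E `` {u' @ v'})
      = (\<Union>u'\<in>?E `` {u}. \<Union>v'\<in>?E `` {v}. ?E `` {u @ v})"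
    by (intro SUP_cong) simp_all
  also have "\<dots> = ?E `` {u @ v}"
    using equiv_class_self[OF equiv_pres_cong] assms by blast
  finally show ?thesis by (simp add: presented_monoid_def)
qed

lemma presented_monoid_carrier:
  "carrier (presented_monoid A R) = (\<lambda>w. pres_cong A R `` {w}) ` lists A"
  by (auto simp: presented_monoid_def quotient_def)

lemma monoid_presented_monoid: "monoid (presented_monoid A R)"
proof (rule monoidI)
  show one: "\<one>\<^bsub>presented_monoid A R\<^esub> \<in> carrier (presented_monoid A R)"
    by (auto simp: presented_monoid_def intro: quotientI)
  fix x assume "x \<in> carrier (presented_monoid A R)"
  then obtain w where "w \<in> lists A" "x = pres_cong A R `` {w}"
    unfolding presented_monoid_carrier by blast
  moreover have "\<one>\<^bsub>presented_monoid A R\<^esub> = pres_cong A R `` {[]}"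
    by (simp add: presented_monoid_def)
  ultimately show "\<one>\<^bsub>presented_monoid A R\<^esub> \<otimes>\<^bsub>presented_monoid A R\<^esub> x = x"
    "x \<otimes>\<^bsub>presented_monoid A R\<^esub> \<one>\<^bsub>presented_monoid A R\<^esub> = x"
    using presented_monoid_mult_class[of "[]" w] presented_monoid_mult_class[of w "[]"] by auto
next
  fix x y z assume "x \<in> carrier (presented_monoid A R)" "y \<in> carrier (presented_monoid A R)"
  then obtain u v where uv: "u \<in> lists A" "x = pres_cong A R `` {u}" "v \<in> lists A" "y = pres_cong A R `` {v}"
    unfolding presented_monoid_carrier by blast
  then have xy: "x \<otimes>\<^bsub>presented_monoid A R\<^esub> y = pres_cong A R `` {u @ v}" and "u @ v \<in> lists A"
    using presented_monoid_mult_class[of u v] by (simp_all only: append_in_lists_conv)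
  then show "x \<otimes>\<^bsub>presented_monoid A R\<^esub> y \<in> carrier (presented_monoid A R)"
    unfolding presented_monoid_carrier by blast
  assume "z \<in> carrier (presented_monoid A R)"
  then obtain w where w: "w \<in> lists A" "z = pres_cong A R `` {w}"
    unfolding presented_monoid_carrier by blast
  with uv have "y \<otimes>\<^bsub>presented_monoid A R\<^esub> z = pres_cong A R `` {v @ w}" "v @ w \<in> lists A"
    using presented_monoid_mult_class[of v w] by (simp_all only: append_in_lists_conv)
  with xy uv w \<open>u @ v \<in> lists A\<close> show "x \<otimes>\<^bsub>presented_monoid A R\<^esub> y \<otimes>\<^bsub>presented_monoid A R\<^esub> z
      = x \<otimes>\<^bsub>presented_monoid A R\<^esub> (y \<otimes>\<^bsub>presented_monoid A R\<^esub> z)"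
    by (metis presented_monoid_mult_class append_assoc)
qed

end


section \<open>Left divisibility\<close>

lemma left_divisibility_order_simps [simp]:
  "carrier (left_divisibility_order G) = carrier G"
  "x \<sqsubseteq>\<^bsub>left_divisibility_order G\<^esub> y \<longleftrightarrow> x divides\<^bsub>G\<^esub> y"
  "x .=\<^bsub>left_divisibility_order G\<^esub> y \<longleftrightarrow> x = y"
  by (simp_all add: left_divisibility_order_def)

lemma lless_left_divisibility_order [simp]:
  "x \<sqsubset>\<^bsub>left_divisibility_order G\<^esub> y \<longleftrightarrow> x divides\<^bsub>G\<^esub> y \<and> x \<noteq> y"
  by (simp add: lless_def)

context monoid
begin

text \<open>Antisymmetry is the only real point: mutual divisors give \<open>x = x c d\<close>,
  cancellation yields \<open>c d = 1\<close>, and then \<open>conical\<close> gives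
  \<open>c = 1\<close>.\<close>

lemma partial_order_left_divisibility:
  assumes canc: "left_cancellative G"
    and conical: "\<And>x y. x \<in> carrier G \<Longrightarrow> y \<in> carrier G \<Longrightarrow> x \<otimes> y = \<one> \<Longrightarrow> x = \<one>"
  shows "partial_order (left_divisibility_order G)"
proof unfold_locales
  fix x y assume xy: "x \<in> carrier (left_divisibility_order G)"
    "x \<sqsubseteq>\<^bsub>left_divisibility_order G\<^esub> y" "y \<sqsubseteq>\<^bsub>left_divisibility_order G\<^esub> x"
  then obtain c d where cd: "y = x \<otimes> c" "x = y \<otimes> d" "c \<in> carrier G" "d \<in> carrier G"
    unfolding left_divisibility_order_simps by (metis dividesD)
  have x: "x \<in> carrier G" using xy(1) by simp
  have "x = x \<otimes> c \<otimes> d" using cd(2) unfolding cd(1) .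
  then have "x \<otimes> (c \<otimes> d) = x \<otimes> \<one>" using m_assoc[OF x cd(3,4)] r_one[OF x] by metis
  then have "c \<otimes> d = \<one>" using canc cd(3,4) x unfolding left_cancellative_def by blast
  then have "c = \<one>" using conical[OF cd(3,4)] by simp
  with cd(1) x show "x .=\<^bsub>left_divisibility_order G\<^esub> y" by simp
qed (simp_all add: left_divisibility_order_def, rule divides_trans)

text \<open>Left multiplication by \<open>p\<close> is an isomorphism onto the principal filter of \<open>p\<close>.\<close>

lemma principal_filter_left_divisibility:
  assumes canc: "left_cancellative G" and p: "p \<in> carrier G"
  shows "poset_isomorphic (principal_filter (left_divisibility_order G) p) (left_divisibility_order G)"
proof -
  let ?P = "left_divisibility_order G" and ?f = "inv_into (carrier G) ((\<otimes>) p)"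
  have inj: "inj_on ((\<otimes>) p) (carrier G)"
    using canc p unfolding inj_on_def left_cancellative_def by blast
  have filter: "carrier (principal_filter ?P p) = (\<otimes>) p ` carrier G"
    using p by (simp add: principal_filter_def set_eq_iff image_iff factor_def) (metis m_closed)
  have "bij_betw ?f (carrier (principal_filter ?P p)) (carrier G)"
    unfolding filter by (rule bij_betw_inv_into[OF bij_betw_imageI[OF inj HOL.refl]])
  moreover have "p \<otimes> x divides p \<otimes> y \<longleftrightarrow> x divides y" if "x \<in> carrier G" "y \<in> carrier G" for x y
  proof
    assume "p \<otimes> x divides p \<otimes> y"
    then obtain c where "c \<in> carrier G" "p \<otimes> y = p \<otimes> x \<otimes> c"
      unfolding factor_def by blast
    then have "p \<otimes> y = p \<otimes> (x \<otimes> c)" using that p by (simp add: m_assoc)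
    then have "y = x \<otimes> c"
      using canc that p unfolding left_cancellative_def using \<open>c \<in> carrier G\<close> by (metis m_closed)
    then show "x divides y" using \<open>c \<in> carrier G\<close> by (auto simp: factor_def)
  qed (use that p in \<open>auto intro: divides_mult_lI\<close>)
  then have "x \<sqsubseteq>\<^bsub>principal_filter ?P p\<^esub> y \<longleftrightarrow> ?f x \<sqsubseteq>\<^bsub>?P\<^esub> ?f y"
    if "x \<in> carrier (principal_filter ?P p)" "y \<in> carrier (principal_filter ?P p)" for x y
    using that inj unfolding filter
    by (elim imageE) (simp add: principal_filter_def left_divisibility_order_def)
  ultimately show ?thesis unfolding poset_isomorphic_def by force
qed

end


section \<open>Graded posets\<close>

lemma (in partial_order) bottom_eqI: "least L b (carrier L) \<Longrightarrow> \<bottom> = b"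
  unfolding bottom_def by (rule some_equality) (auto intro: least_unique)

text \<open>\<open>pred_on.chain\<close> compares through the reflexive closure of the order, which
  on the carrier is the order itself.\<close>

lemma (in partial_order) chain_iff:
  assumes "A \<subseteq> carrier L"
  shows "pred_on.chain A (le L) C \<longleftrightarrow> C \<subseteq> A \<and> (\<forall>x\<in>C. \<forall>y\<in>C. x \<sqsubseteq> y \<or> y \<sqsubseteq> x)"
proof -
  have "(le L)\<^sup>=\<^sup>= x y \<longleftrightarrow> x \<sqsubseteq> y" if "C \<subseteq> A" "x \<in> C" for x y
    using le_refl[of x] that assms by auto
  then show ?thesis unfolding pred_on.chain_def by meson
qed

text \<open>A local criterion for gradedness: rank strictly increases, and every strict relation can
  be started by a step of rank one. It is easy to check for both posets of the theorem and forces
  the required shape of all maximal chains.\<close>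

locale graded_poset = partial_order L for L (structure) +
  fixes \<rho> :: "'a \<Rightarrow> nat" and b :: 'a
  assumes least: "least L b (carrier L)"
    and rank_b: "\<rho> b = 0"
    and rank_less: "\<lbrakk>x \<in> carrier L; y \<in> carrier L; x \<sqsubset> y\<rbrakk> \<Longrightarrow> \<rho> x < \<rho> y"
    and next_below: "\<lbrakk>x \<in> carrier L; y \<in> carrier L; x \<sqsubset> y\<rbrakk> \<Longrightarrow>
      \<exists>z\<in>carrier L. x \<sqsubset> z \<and> z \<sqsubseteq> y \<and> \<rho> z = Suc (\<rho> x)"
begin

lemma bottom: "\<bottom> = b"
  using least by (rule bottom_eqI)

lemma b_least: "b \<in> carrier L" "x \<in> carrier L \<Longrightarrow> b \<sqsubseteq> x"
  using least by (auto simp: least_def)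

lemma rank_mono: "\<lbrakk>x \<in> carrier L; y \<in> carrier L; x \<sqsubseteq> y\<rbrakk> \<Longrightarrow> \<rho> x \<le> \<rho> y"
  using rank_less[of x y] by (cases "x = y") (auto simp: lless_eq)

lemma covered_byI:
  assumes "x \<in> carrier L" "y \<in> carrier L" "x \<sqsubset> y" "\<rho> y = Suc (\<rho> x)"
  shows "covered_by L x y"
  using assms rank_less[of x] rank_less[of _ y] unfolding covered_by_def by fastforce

text \<open>If \<open>x\<close> covers the minimum, the rank-one element that
  \<open>next_below\<close> finds between them must be \<open>x\<close>.\<close>

lemma atoms_eq: "atoms L = {x \<in> carrier L. \<rho> x = 1}"
proof (intro equalityI subsetI)
  fix x assume "x \<in> atoms L"
  then have x: "x \<in> carrier L" "b \<sqsubset> x" "\<not> (\<exists>z\<in>carrier L. b \<sqsubset> z \<and> z \<sqsubset> x)"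
    by (auto simp: atoms_def covered_by_def bottom)
  obtain z where z: "z \<in> carrier L" "b \<sqsubset> z" "z \<sqsubseteq> x" "\<rho> z = Suc (\<rho> b)"
    using next_below[OF b_least(1) x(1,2)] by auto
  with x have "z = x" by (auto simp: lless_eq)
  with z show "x \<in> {x \<in> carrier L. \<rho> x = 1}" by (simp add: rank_b)
next
  fix x assume "x \<in> {x \<in> carrier L. \<rho> x = 1}"
  then show "x \<in> atoms L"
    using b_least rank_b unfolding atoms_def bottom
    by (auto intro!: covered_byI simp: lless_eq)
qed

section \<open>Maximal chains of a graded poset\<close>

context
  fixes C assumes C: "maximal_chain L C"
begin

lemma maximal_chain_subset: "C \<subseteq> carrier L"
  and maximal_chain_total: "\<lbrakk>x \<in> C; y \<in> C\<rbrakk> \<Longrightarrow> x \<sqsubseteq> y \<or> y \<sqsubseteq> x"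
  using C unfolding pred_on.maxchain_def chain_iff[OF subset_refl] by blast+

text \<open>Otherwise adjoining \<open>z\<close> would give a larger chain.\<close>

lemma maximal_chain_memI:
  assumes z: "z \<in> carrier L" "\<And>x. x \<in> C \<Longrightarrow> x \<sqsubseteq> z \<or> z \<sqsubseteq> x"
  shows "z \<in> C"
proof (rule ccontr)
  assume "z \<notin> C"
  moreover have "pred_on.chain (carrier L) (le L) (insert z C)"
    unfolding chain_iff[OF subset_refl]
    using z maximal_chain_subset maximal_chain_total le_refl[of z] by blast
  ultimately show False using C unfolding pred_on.maxchain_def by blast
qed

lemma maximal_chain_le_iff:
  assumes "x \<in> C" "y \<in> C"
  shows "x \<sqsubseteq> y \<longleftrightarrow> \<rho> x \<le> \<rho> y"
proof -
  have "x \<in> carrier L" "y \<in> carrier L" using assms maximal_chain_subset by blast+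
  then show ?thesis
    using maximal_chain_total[OF assms] rank_less[of y x] rank_mono[of x y] le_refl[of x]
    unfolding lless_eq by (metis not_less)
qed

lemma maximal_chain_rank_inj: "\<lbrakk>x \<in> C; y \<in> C; \<rho> x = \<rho> y\<rbrakk> \<Longrightarrow> x = y"
  using maximal_chain_le_iff[of x y] maximal_chain_le_iff[of y x] maximal_chain_subset
  by (metis le_antisym order.refl subsetD)

lemma maximal_chain_b: "b \<in> C"
  by (rule maximal_chain_memI) (use maximal_chain_subset b_least in blast)+

text \<open>An element \<open>z\<close> one rank above \<open>x\<close> and below \<open>y\<close>
  is comparable with all of \<open>C\<close>: elements of rank at most that of \<open>x\<close> lie
  below \<open>x\<close>, the others above \<open>y\<close>. Maximality puts \<open>z\<close> into
  \<open>C\<close>.\<close>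

lemma maximal_chain_next:
  assumes x: "x \<in> C" and y: "y \<in> carrier L" "x \<sqsubset> y" and yC: "\<And>c. c \<in> C \<Longrightarrow> \<rho> x < \<rho> c \<Longrightarrow> y \<sqsubseteq> c"
  shows "\<exists>z\<in>C. \<rho> z = Suc (\<rho> x)"
proof -
  have xc: "x \<in> carrier L" using x maximal_chain_subset by auto
  obtain z where z: "z \<in> carrier L" "x \<sqsubset> z" "z \<sqsubseteq> y" "\<rho> z = Suc (\<rho> x)"
    using next_below[OF xc y] by auto
  have "z \<in> C"
  proof (rule maximal_chain_memI)
    fix c assume c: "c \<in> C"
    then have cc: "c \<in> carrier L" using maximal_chain_subset by auto
    show "c \<sqsubseteq> z \<or> z \<sqsubseteq> c"
    proof (cases "\<rho> c \<le> \<rho> x")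
      case True
      then have "c \<sqsubseteq> x" using maximal_chain_le_iff c x by auto
      then show ?thesis using z xc cc le_trans[of c x z] by (auto simp: lless_eq)
    next
      case False
      then have "y \<sqsubseteq> c" using yC c by auto
      then show ?thesis using z y cc le_trans[of z y c] by auto
    qed
  qed (use z in auto)
  with z show ?thesis by auto
qed

text \<open>Take \<open>x\<close> and \<open>y\<close> in \<open>C\<close> nearest to the cut
  between ranks \<open>k\<close> and \<open>k + 1\<close>, one on each side.
  \<open>maximal_chain_next\<close> gives an element of \<open>C\<close> one rank above
  \<open>x\<close>, which contradicts the choice of \<open>x\<close> unless \<open>x\<close> has
  rank \<open>k\<close>.\<close>

lemma maximal_chain_rank_pred:
  assumes "c \<in> C" "\<rho> c = Suc k"
  shows "\<exists>z\<in>C. \<rho> z = k"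
proof -
  let ?S = "{x \<in> C. \<rho> x \<le> k}"
  have "\<exists>x. x \<in> ?S \<and> (\<forall>y. y \<in> ?S \<longrightarrow> \<rho> y \<le> \<rho> x)"
    by (rule ex_has_greatest_nat[of _ b _ "Suc k"]) (auto simp: maximal_chain_b rank_b)
  then obtain x where x: "x \<in> C" "\<rho> x \<le> k" "\<And>y. y \<in> C \<Longrightarrow> \<rho> y \<le> k \<Longrightarrow> \<rho> y \<le> \<rho> x" by auto
  have "c \<in> {y \<in> C. k < \<rho> y}" using assms by auto
  then obtain y where y: "y \<in> C" "k < \<rho> y" "\<And>z. z \<in> C \<Longrightarrow> k < \<rho> z \<Longrightarrow> \<rho> y \<le> \<rho> z"
    using ex_has_least_nat[of "\<lambda>y. y \<in> C \<and> k < \<rho> y" c \<rho>] by auto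
  have "\<rho> x < \<rho> y" using x(2) y(2) by simp
  then have xy: "x \<sqsubset> y" using maximal_chain_le_iff[OF x(1) y(1)] unfolding lless_eq by auto
  have "y \<sqsubseteq> c'" if "c' \<in> C" "\<rho> x < \<rho> c'" for c'
    using maximal_chain_le_iff[OF y(1) that(1)] that x(3)[OF that(1)] y(3)[OF that(1)] by linarith
  then obtain z where z: "z \<in> C" "\<rho> z = Suc (\<rho> x)"
    using maximal_chain_next[OF x(1) subsetD[OF maximal_chain_subset y(1)] xy] by metis
  then have "\<rho> x = k" using x(2) x(3)[OF z(1)] by linarith
  then show ?thesis using x by auto
qed

lemma maximal_chain_rank_downward:
  "\<lbrakk>c \<in> C; k \<le> \<rho> c\<rbrakk> \<Longrightarrow> \<exists>z\<in>C. \<rho> z = k"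
proof (induction "\<rho> c" arbitrary: c)
  case 0
  then show ?case by auto
next
  case (Suc m)
  then show ?case using maximal_chain_rank_pred[of c m]
    by (metis le_SucE)
qed

text \<open>Rank is injective on \<open>C\<close>, so its inverse enumerates \<open>C\<close>;
  neighbours in the enumeration differ by one in rank, hence form a covering.\<close>

lemma ranked_chain_maximal_chain:
  assumes N: "\<rho> ` C = {i. enat i < N}"
  shows "ranked_chain L \<rho> N C"
  unfolding ranked_chain_def bottom
proof (intro conjI exI allI impI)
  let ?x = "inv_into C \<rho>"
  have inj: "inj_on \<rho> C" using maximal_chain_rank_inj by (auto simp: inj_on_def)
  have x: "?x i \<in> C" "\<rho> (?x i) = i" if "enat i < N" for i
    using that N by (auto intro: inv_into_into f_inv_into_f)
  show "0 < N" using N maximal_chain_b rank_b by (metis mem_Collect_eq imageI zero_enat_def)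
  show "C = ?x ` {i. enat i < N}"
    using inj unfolding N[symmetric] by (auto simp: image_image inv_into_f_f)
  show "?x 0 = b" using inj maximal_chain_b rank_b by (metis inv_into_f_f)
  show "\<rho> (?x i) = i" if "enat i < N" for i using x that by auto
  show "covered_by L (?x i) (?x (Suc i))" if i: "enat (Suc i) < N" for i
  proof -
    have "enat i < N" using i by (metis enat_ord_simps(2) lessI order.strict_trans)
    then have C: "?x i \<in> C" "?x (Suc i) \<in> C" and r: "\<rho> (?x i) = i" "\<rho> (?x (Suc i)) = Suc i"
      using x i by blast+
    moreover have "?x i \<noteq> ?x (Suc i)" using r by (metis n_not_Suc_n)
    ultimately show ?thesis
      using maximal_chain_le_iff[of "?x i" "?x (Suc i)"] maximal_chain_subset
      by (intro covered_byI) (auto simp: lless_eq)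
  qed
qed

text \<open>The ranks occurring in \<open>C\<close> are closed downward, so they are all naturals or
  exactly those below the first missing one.\<close>

lemma ex_ranked_chain_maximal_chain: "\<exists>N. ranked_chain L \<rho> N C"
proof (cases "\<rho> ` C = UNIV")
  case True
  then show ?thesis using ranked_chain_maximal_chain[of \<infinity>] by auto
next
  case False
  define m where "m = (LEAST k. k \<notin> \<rho> ` C)"
  have m: "m \<notin> \<rho> ` C" "\<And>k. k < m \<Longrightarrow> k \<in> \<rho> ` C"
    using LeastI_ex[of "\<lambda>k. k \<notin> \<rho> ` C"] not_less_Least[of _ "\<lambda>k. k \<notin> \<rho> ` C"] False
    unfolding m_def by blast+
  then have "\<rho> c < m" if "c \<in> C" for c
    using maximal_chain_rank_downward[OF that, of m] by (metis imageI not_less)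
  with m(2) have "\<rho> ` C = {i. enat i < enat m}" by auto
  then show ?thesis using ranked_chain_maximal_chain by blast
qed

lemma infinite_ranked_chain_maximal_chain:
  assumes no_max: "\<And>x. x \<in> carrier L \<Longrightarrow> \<exists>y\<in>carrier L. x \<sqsubset> y"
  shows "ranked_chain L \<rho> \<infinity> C"
proof (rule ranked_chain_maximal_chain)
  have "\<exists>c\<in>C. \<rho> c = k" for k
  proof (induction k)
    case 0
    then show ?case using maximal_chain_b rank_b by auto
  next
    case (Suc k)
    then obtain c where c: "c \<in> C" "\<rho> c = k" by auto
    show ?case
    proof (cases "\<exists>d\<in>C. k < \<rho> d")
      case True
      then show ?thesis using maximal_chain_rank_downward[of _ "Suc k"] by auto
    next
      case False
      \<comment> \<open>Here \<open>c\<close> has the largest rank in \<open>C\<close>, so the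
        condition of \<open>maximal_chain_next\<close> on later elements is vacuous and any
        \<open>y\<close> above \<open>c\<close> yields the next rank.\<close>
      obtain y where "y \<in> carrier L" "c \<sqsubset> y"
        using no_max[of c] c maximal_chain_subset by auto
      then show ?thesis using maximal_chain_next[OF c(1)] False c by auto
    qed
  qed
  then show "\<rho> ` C = {i. enat i < \<infinity>}" by (auto simp: image_iff) metis
qed

end

lemma rank_function: "rank_function L \<rho>"
  using ex_ranked_chain_maximal_chain by (auto simp: rank_function_def bottom rank_b)

section \<open>Finite type gradings, and lattices from joins\<close>

lemma finite_type_N_gradedI:
  assumes "\<And>x. x \<in> carrier L \<Longrightarrow> \<exists>y\<in>carrier L. x \<sqsubset> y"
    and "\<And>k. finite {p \<in> carrier L. \<rho> p = k}"
  shows "finite_type_N_graded L"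
  unfolding finite_type_N_graded_def
proof (intro conjI exI allI impI)
  show "least L b (carrier L)" by (rule least)
  show "\<rho> \<bottom> = 0" by (simp add: bottom rank_b)
  show "ranked_chain L \<rho> \<infinity> C" if "maximal_chain L C" for C
    using that assms(1) by (rule infinite_ranked_chain_maximal_chain)
  show "finite {p \<in> carrier L. \<rho> p = k}" for k by (rule assms(2))
qed (rule partial_order_axioms)

text \<open>The meet of two elements is a common lower bound of maximal rank.\<close>

lemma lattice_if_joins:
  assumes joins: "\<And>x y. x \<in> carrier L \<Longrightarrow> y \<in> carrier L \<Longrightarrow> \<exists>s. least L s (Upper L {x, y})"
  shows "lattice L"
proof unfold_locales
  fix x y assume x: "x \<in> carrier L" and y: "y \<in> carrier L"
  show "\<exists>s. least L s (Upper L {x, y})" by (rule joins[OF x y])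
  define lower where "lower z \<longleftrightarrow> z \<in> carrier L \<and> z \<sqsubseteq> x \<and> z \<sqsubseteq> y" for z
  have "lower b" using b_least x y unfolding lower_def by blast
  moreover have "\<rho> z < Suc (\<rho> x)" if "lower z" for z
    using that rank_mono[of z x] x unfolding lower_def by simp
  ultimately obtain g where g: "lower g" and max: "\<And>z. lower z \<Longrightarrow> \<rho> z \<le> \<rho> g"
    using Lattices_Big.ex_has_greatest_nat[of lower b \<rho> "Suc (\<rho> x)"] by blast
  have gc: "g \<in> carrier L" using g by (simp add: lower_def)
  have "d \<sqsubseteq> g" if d: "lower d" for d
  proof -
    have dc: "d \<in> carrier L" using d by (simp add: lower_def)
    obtain s where s: "least L s (Upper L {g, d})" using joins[OF gc dc] by blast
    then have sc: "s \<in> carrier L" and gs: "g \<sqsubseteq> s" and ds: "d \<sqsubseteq> s"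
      using least_closed[OF s] gc dc unfolding least_def Upper_def by blast+
    have "s \<sqsubseteq> z" if "z \<in> carrier L" "g \<sqsubseteq> z" "d \<sqsubseteq> z" for z
      using s that unfolding least_def Upper_def by blast
    \<comment> \<open>The join of \<open>g\<close> and \<open>d\<close> is again a lower bound of
      \<open>x\<close> and \<open>y\<close>, so the maximal rank of \<open>g\<close> forces it to
      equal \<open>g\<close>.\<close>
    then have "lower s" using g d x y sc unfolding lower_def by blast
    then have "\<rho> s \<le> \<rho> g" by (rule max)
    then have "s = g" using rank_less[OF gc sc] gs unfolding lless_eq by force
    then show ?thesis using ds by simp
  qed
  then have "greatest L g (Lower L {x, y})"
    using g x y unfolding greatest_def Lower_def lower_def by blast
  then show "\<exists>s. greatest L s (Lower L {x, y})" ..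
qed

text \<open>Hausdorff's principle is applied among the elements comparable with \<open>p\<close>. A
  maximal chain there contains \<open>p\<close>, so any larger chain of the whole poset would also
  consist of elements comparable with \<open>p\<close>.\<close>

lemma ex_maximal_chain:
  assumes p: "p \<in> carrier L"
  shows "\<exists>C. maximal_chain L C \<and> p \<in> C"
proof -
  let ?A = "{q \<in> carrier L. p \<sqsubseteq> q \<or> q \<sqsubseteq> p}"
  have A: "?A \<subseteq> carrier L" by blast
  obtain C where C: "pred_on.maxchain ?A (le L) C" using pred_on.Hausdorff by blast
  then have chain: "C \<subseteq> ?A" "\<And>x y. x \<in> C \<Longrightarrow> y \<in> C \<Longrightarrow> x \<sqsubseteq> y \<or> y \<sqsubseteq> x"
    and max: "\<And>D. pred_on.chain ?A (le L) D \<Longrightarrow> C \<subseteq> D \<Longrightarrow> D = C"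
    unfolding pred_on.maxchain_def chain_iff[OF A] by blast+
  have "pred_on.chain ?A (le L) (insert p C)"
    unfolding chain_iff[OF A] using chain p le_refl[of p] by blast
  then have pC: "p \<in> C" using max[of "insert p C"] by blast
  have "D = C" if D: "pred_on.chain (carrier L) (le L) D" "C \<subseteq> D" for D
  proof (rule max)
    have "D \<subseteq> ?A" using D pC unfolding chain_iff[OF subset_refl] by blast
    then show "pred_on.chain ?A (le L) D"
      using D unfolding chain_iff[OF subset_refl] chain_iff[OF A] by blast
  qed (use D in blast)
  moreover have "pred_on.chain (carrier L) (le L) C"
    using chain unfolding chain_iff[OF subset_refl] by blast
  ultimately show ?thesis using pC unfolding pred_on.maxchain_def by blast
qed

end

text \<open>A rank function counts the elements below in any maximal chain, so it is unique.\<close>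

lemma (in partial_order) ranked_chain_rank_eq_card:
  assumes "ranked_chain L \<rho> N C" "p \<in> C" "C \<subseteq> carrier L"
  shows "\<rho> p = card {z \<in> C. z \<sqsubset> p}"
proof -
  obtain x where x: "C = x ` {i. enat i < N}"
    "\<And>i. enat (Suc i) < N \<Longrightarrow> covered_by L (x i) (x (Suc i))"
    "\<And>i. enat i < N \<Longrightarrow> \<rho> (x i) = i"
    using assms(1) unfolding ranked_chain_def by blast
  have xC: "x i \<in> carrier L" if "enat i < N" for i using that x(1) assms(3) by auto
  have less: "x i \<sqsubset> x j" if "i < j" "enat j < N" for i j
    using that
  proof (induction j)
    case (Suc j)
    have j: "enat j < N" using Suc.prems(2) by (metis enat_ord_simps(2) lessI order.strict_trans)
    have c: "x j \<sqsubset> x (Suc j)" using x(2)[OF Suc.prems(2)] by (auto simp: covered_by_def)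
    show ?case
    proof (cases "i = j")
      case False
      then have "x i \<sqsubset> x j" using Suc.IH Suc.prems(1) j by (metis less_antisym)
      moreover have "enat i < N" using Suc.prems by (metis enat_ord_simps(2) order.strict_trans)
      ultimately show ?thesis using lless_trans[OF _ c] xC[OF j] xC[OF Suc.prems(2)] xC by metis
    qed (use c in auto)
  qed auto
  obtain i where i: "p = x i" "enat i < N" using assms x by auto
  have le: "enat j < N" if "j < i" for j using that i by (metis enat_ord_simps(2) order.strict_trans)
  have "{z \<in> C. z \<sqsubset> p} = x ` {..<i}"
  proof (intro equalityI subsetI)
    fix z assume "z \<in> {z \<in> C. z \<sqsubset> p}"
    then obtain j where j: "z = x j" "enat j < N" "x j \<sqsubset> x i" using x(1) i by auto
    have "j < i"
    proof (rule ccontr)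
      assume "\<not> j < i"
      then have "i = j \<or> x i \<sqsubset> x j" using less[OF _ j(2), of i] by linarith
      moreover have "\<not> x i \<sqsubset> x i" unfolding lless_eq by simp
      ultimately show False using j(3) lless_antisym[OF xC[OF i(2)] xC[OF j(2)]] by metis
    qed
    then show "z \<in> x ` {..<i}" using j by auto
  next
    fix z assume "z \<in> x ` {..<i}"
    then show "z \<in> {z \<in> C. z \<sqsubset> p}" using less i x(1) le by auto
  qed
  moreover have "inj_on x {..<i}"
    by (rule inj_on_inverseI[of _ \<rho>]) (use x(3) le in auto)
  ultimately show ?thesis using i x(3) by (simp add: card_image)
qed

text \<open>\<open>rank\<close> is an arbitrary choice, but on a maximal chain through
  \<open>p\<close> both it and \<rho> count the elements below \<open>p\<close>.\<close>

lemma (in graded_poset) rank_eq: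
  assumes p: "p \<in> carrier L"
  shows "rank L p = \<rho> p"
proof -
  have rank: "rank_function L (rank L)"
    unfolding rank_def by (rule someI[of _ \<rho>]) (rule rank_function)
  obtain C where C: "maximal_chain L C" "p \<in> C" using ex_maximal_chain[OF p] by auto
  then obtain N N' where N: "ranked_chain L \<rho> N C" "ranked_chain L (rank L) N' C"
    using rank ex_ranked_chain_maximal_chain unfolding rank_function_def by blast
  show ?thesis
    using N[THEN ranked_chain_rank_eq_card, OF C(2) maximal_chain_subset[OF C(1)]] by simp
qed


section \<open>Normal forms of words\<close>

text \<open>\<open>act n u w\<close> is the normal form of the product \<open>u w\<close> if \<open>w\<close> is in normal form.\<close>

definition head :: "nat \<Rightarrow> nat \<Rightarrow> nat list \<Rightarrow> nat" where
  "head n i w = (if take (n - 1) w = replicate (n - 1) 1 then 1 else i)"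

definition act :: "nat \<Rightarrow> nat list \<Rightarrow> nat list \<Rightarrow> nat list" where
  "act n u w = foldr (\<lambda>i v. head n i v # v) u w"

text \<open>Left divisibility when \<open>d\<close> is a normal form. The cofactor \<open>v\<close>
  is left unrestricted: it is a suffix of \<open>d\<close> and so inherits its letters from
  \<open>d\<close>.\<close>

definition ldiv :: "nat \<Rightarrow> nat list \<Rightarrow> nat list \<Rightarrow> bool" where
  "ldiv n u d \<longleftrightarrow> (\<exists>v. d = act n u v)"

lemma act_Nil [simp]: "act n [] w = w"
  and act_Cons [simp]: "act n (i # u) w = head n i (act n u w) # act n u w"
  and act_append [simp]: "act n (u @ v) w = act n u (act n v w)"
  by (simp_all add: act_def)

lemma head_one [simp]: "head n (Suc 0) w = Suc 0"
  by (simp add: head_def)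

lemma head_replicate_append: "n - 1 \<le> k \<Longrightarrow> head n i (replicate k 1 @ w) = 1"
  by (simp add: head_def min_def)

lemma act_replicate_one [simp]: "act n (replicate k (Suc 0)) w = replicate k (Suc 0) @ w"
  by (induction k) auto

lemma length_act [simp]: "length (act n u w) = length u + length w"
  by (induction u) auto

text \<open>Rewriting touches only the letter just prepended, so the old word survives as a suffix;
  left cancellation comes from here.\<close>

lemma drop_act: "drop (length u) (act n u w) = w"
  by (induction u) auto

lemma act_inject: "act n u v = act n u w \<Longrightarrow> v = w"
  by (metis drop_act)

lemma act_in_lists: "1 \<in> A \<Longrightarrow> u \<in> lists A \<Longrightarrow> w \<in> lists A \<Longrightarrow> act n u w \<in> lists A"
  by (induction u) (auto simp: head_def)

lemma head_eq_iff: "head n i v = head n j v \<longleftrightarrow> i = j \<or> take (n - 1) v = replicate (n - 1) 1"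
  by (auto simp: head_def)

section \<open>Left divisibility and least common multiples of words\<close>

lemma ldiv_Nil [simp]: "ldiv n [] d"
  by (simp add: ldiv_def)

lemma ldiv_Cons: "ldiv n (i # u) d \<longleftrightarrow> (\<exists>v. d = head n i v # v \<and> ldiv n u v)"
  by (auto simp: ldiv_def)

text \<open>The letter 1 is never changed, so dividing by a power of it means having that power as a
  prefix.\<close>

lemma ldiv_replicate_one: "ldiv n (replicate k 1) d \<longleftrightarrow> take k d = replicate k 1"
proof
  assume "take k d = replicate k 1"
  then have "d = act n (replicate k 1) (drop k d)"
    using append_take_drop_id[of k d] by simp
  then show "ldiv n (replicate k 1) d" unfolding ldiv_def ..
qed (auto simp: ldiv_def)

lemma ldiv_replicate_one_max:
  "ldiv n (replicate k 1) d \<and> ldiv n (replicate l 1) d \<longleftrightarrow> ldiv n (replicate (max k l) 1) d"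
proof (cases "k \<le> l")
  case True
  then have "take k d = replicate k 1" if "take l d = replicate l 1"
    using arg_cong[OF that, of "take k"] by (simp add: min_def)
  with True show ?thesis unfolding ldiv_replicate_one by (auto simp: max_def)
next
  case False
  then have "take l d = replicate l 1" if "take k d = replicate k 1"
    using arg_cong[OF that, of "take l"] by (simp add: min_def)
  with False show ?thesis unfolding ldiv_replicate_one by (auto simp: max_def)
qed

text \<open>Both divisors leave the same suffix \<open>w\<close>, the tail of \<open>d\<close>.
  Distinct letters can yield the same leading letter only if at least one of them is rewritten to 1,
  which requires \<open>w\<close> to start with \<open>n - 1\<close> letters 1.\<close>

lemma ldiv_Cons_Cons:
  assumes "i \<noteq> j"
  shows "ldiv n (i # u) d \<and> ldiv n (j # v) d \<longleftrightarrow>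
    (\<exists>w. d = 1 # w \<and> ldiv n u w \<and> ldiv n v w \<and> ldiv n (replicate (n - 1) 1) w)"
  unfolding ldiv_Cons ldiv_replicate_one using assms
  by (auto simp: head_eq_iff head_def split: if_splits)

text \<open>Induction on \<open>u\<close> with \<open>k\<close> arbitrary, because passing to the
  tails may change the exponent.\<close>

lemma ex_lcm_replicate_one:
  assumes "1 \<in> A" "u \<in> lists A"
  shows "\<exists>c\<in>lists A. \<forall>d. ldiv n c d \<longleftrightarrow> ldiv n u d \<and> ldiv n (replicate k 1) d"
  using assms(2)
proof (induction u arbitrary: k)
  case Nil
  show ?case using assms(1) by (intro bexI[of _ "replicate k 1"]) auto
next
  case (Cons i u)
  show ?case
  proof (cases k)
    case 0
    then show ?thesis using Cons.hyps by (intro bexI[of _ "i # u"]) auto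
  next
    case (Suc m)
    \<comment> \<open>If \<open>i = 1\<close>, only the first letters are stripped. Otherwise the
      tail must also start with \<open>n - 1\<close> letters 1, and the two powers of 1 merge into
      the larger one.\<close>
    define l where "l = (if i = 1 then m else max m (n - 1))"
    obtain c where c: "c \<in> lists A"
      "\<And>d. ldiv n c d \<longleftrightarrow> ldiv n u d \<and> ldiv n (replicate l 1) d"
      using Cons.IH[of l] by blast
    have "ldiv n (1 # c) d \<longleftrightarrow> ldiv n (i # u) d \<and> ldiv n (replicate k 1) d" for d
    proof (cases "i = 1")
      case True
      then show ?thesis using Suc by (auto simp: ldiv_Cons c(2) l_def)
    next
      case False
      then show ?thesis using ldiv_Cons_Cons[of i 1 n u d "replicate m 1"]
        ldiv_replicate_one_max[of n m _ "n - 1"] Suc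
        by (simp add: ldiv_Cons[of _ "Suc 0"] c(2) l_def)
    qed
    then show ?thesis using c(1) assms(1) by (intro bexI[of _ "1 # c"]) auto
  qed
qed

text \<open>Equal first letters are stripped. For distinct ones the answer is 1 followed by a common
  multiple of both tails and of the power \<open>n - 1\<close> of 1.\<close>

lemma ex_lcm:
  assumes "1 \<in> A" "u \<in> lists A" "v \<in> lists A"
  shows "\<exists>c\<in>lists A. \<forall>d. ldiv n c d \<longleftrightarrow> ldiv n u d \<and> ldiv n v d"
  using assms(2,3)
proof (induction u arbitrary: v)
  case Nil
  then show ?case by (intro bexI[of _ v]) auto
next
  case (Cons i u)
  show ?case
  proof (cases v)
    case Nil
    then show ?thesis using Cons.hyps by (intro bexI[of _ "i # u"]) auto
  next
    case (Cons j w)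
    then obtain e where e: "e \<in> lists A" "\<And>d. ldiv n e d \<longleftrightarrow> ldiv n u d \<and> ldiv n w d"
      using Cons.IH[of w] Cons.prems by auto
    show ?thesis
    proof (cases "i = j")
      case True
      have "ldiv n (i # e) d \<longleftrightarrow> ldiv n (i # u) d \<and> ldiv n v d" for d
        unfolding Cons True ldiv_Cons e(2) by auto
      then show ?thesis using Cons.hyps e(1) by (intro bexI[of _ "i # e"]) auto
    next
      case False
      \<comment> \<open>The induction hypothesis concerns \<open>u\<close> only and says nothing
        about \<open>e\<close>, which is why powers of 1 are treated beforehand.\<close>
      obtain c where c: "c \<in> lists A"
        "\<And>d. ldiv n c d \<longleftrightarrow> ldiv n e d \<and> ldiv n (replicate (n - 1) 1) d"
        using ex_lcm_replicate_one[OF assms(1) e(1), of n "n - 1"] by blast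
      have "ldiv n (1 # c) d \<longleftrightarrow> ldiv n (i # u) d \<and> ldiv n v d" for d
        unfolding Cons using ldiv_Cons_Cons[OF False, of n u d w]
        by (simp add: ldiv_Cons[of _ "Suc 0"] c(2) e(2) conj_assoc)
      then show ?thesis using c(1) assms(1) by (intro bexI[of _ "1 # c"]) auto
    qed
  qed
qed

text \<open>The tail behind each letter of \<open>u\<close> is shorter than \<open>n - 1\<close>, so
  nothing is rewritten and the letters of \<open>u\<close> appear unchanged.\<close>

lemma ldiv_replicate_oneD: "ldiv n u (replicate k 1) \<Longrightarrow> k \<le> n - 1 \<Longrightarrow> u = replicate (length u) 1"
proof (induction u arbitrary: k)
  case (Cons i u)
  then obtain v where v: "replicate k 1 = head n i v # v" "ldiv n u v"
    by (auto simp: ldiv_Cons)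
  then obtain m where m: "k = Suc m" "v = replicate m 1" by (cases k) auto
  then have "head n i v = i" using Cons.prems(2) by (auto simp: head_def dest!: arg_cong[of _ _ length])
  moreover have "head n i v = 1" using v(1) m(1) by simp
  moreover have "u = replicate (length u) 1" using v(2) m Cons.IH[of m] Cons.prems(2) by simp
  ultimately show ?case using \<open>head n i v = i\<close> by (metis length_Cons replicate_Suc)
qed simp


section \<open>The monoid\<close>

locale chain_monoid =
  fixes n r :: nat
  assumes n: "2 \<le> n" and r: "2 \<le> r"
begin

abbreviation "A \<equiv> {1..r}"
abbreviation "E \<equiv> pres_cong A (M_relations n r)"
abbreviation "M \<equiv> M_monoid n r"
abbreviation "P \<equiv> left_divisibility_order M"

definition cls :: "nat list \<Rightarrow> nat list set" where
  "cls w = E `` {w}"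

text \<open>The choice of representative is immaterial, since the relations preserve length; see
  \<open>rk_cls\<close>.\<close>

definition rk :: "nat list set \<Rightarrow> nat" where
  "rk X = length (SOME w. w \<in> X)"

lemma one_in: "1 \<in> A" "Suc 0 \<in> A"
  using r by auto

lemma M_relations_subset: "M_relations n r \<subseteq> lists A \<times> lists A"
  using r by (auto simp: M_relations_def)

lemma M_relations_iff:
  "(u, v) \<in> M_relations n r \<longleftrightarrow> (\<exists>i\<in>{2..r}. u = i # replicate (n - 1) 1 \<and> v = replicate n 1)"
  by (auto simp: M_relations_def)

lemma equiv_E: "equiv (lists A) E"
  by (rule equiv_pres_cong[OF M_relations_subset])

section \<open>Normal forms decide the congruence\<close>

lemma replicate_n: "replicate n x = x # replicate (n - 1) x"
  using n by (cases n) auto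

text \<open>Both sides of a relation act on any word \<open>w\<close> by prepending \<open>n\<close>
  letters 1. Keeping \<open>w\<close> arbitrary lets the induction pass through
  concatenation.\<close>

lemma act_cong: "(u, v) \<in> E \<Longrightarrow> act n u w = act n v w"
proof (induction arbitrary: w rule: pres_cong.induct)
  case (rel u v)
  then show ?case
    using head_replicate_append[of n "n - 1" _ w] by (auto simp: M_relations_iff replicate_n)
qed auto

text \<open>Converse direction: each change of a leading letter made by \<open>act\<close> is an
  application of a defining relation.\<close>

lemma append_act_E: "u \<in> lists A \<Longrightarrow> w \<in> lists A \<Longrightarrow> (u @ w, act n u w) \<in> E"
proof (induction u)
  case Nil
  then show ?case by (simp add: pres_cong.refl)
next
  case (Cons i u)
  then have i: "i \<in> A" by auto
  define v where "v = act n u w"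
  have v: "v \<in> lists A" using Cons act_in_lists[OF one_in(1)] by (simp add: v_def)
  have "([i] @ (u @ w), [i] @ v) \<in> E"
    using Cons by (intro pres_cong.append pres_cong.refl) (auto simp: v_def)
  moreover have "(i # v, head n i v # v) \<in> E"
  proof (cases "i \<noteq> 1 \<and> take (n - 1) v = replicate (n - 1) 1")
    case True
    then have v': "v = replicate (n - 1) 1 @ drop (n - 1) v"
      using append_take_drop_id[of "n - 1" v] by simp
    have "i \<in> {2..r}" using True i by auto
    then have "(i # replicate (n - 1) 1, replicate n 1) \<in> E"
      by (intro pres_cong.rel) (auto simp: M_relations_iff)
    moreover have "drop (n - 1) v \<in> lists A" using v by (auto dest: in_set_dropD)
    ultimately have "((i # replicate (n - 1) 1) @ drop (n - 1) v, replicate n 1 @ drop (n - 1) v) \<in> E"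
      by (intro pres_cong.append pres_cong.refl)
    with True v' show ?thesis by (simp add: head_def replicate_n)
  next
    case False
    then have "head n i v = i" by (auto simp: head_def)
    then show ?thesis using v i by (auto intro!: pres_cong.refl)
  qed
  ultimately show ?case by (auto simp: v_def intro: pres_cong.trans)
qed

text \<open>This solves the word problem: acting on the empty word computes a canonical
  representative.\<close>

lemma cls_eq_iff:
  assumes "u \<in> lists A" "v \<in> lists A"
  shows "cls u = cls v \<longleftrightarrow> act n u [] = act n v []"
proof
  assume "cls u = cls v"
  then have "(u, v) \<in> E"
    unfolding cls_def using eq_equiv_class_iff[OF equiv_E assms] by simp
  then show "act n u [] = act n v []" by (rule act_cong)
next
  assume "act n u [] = act n v []"
  then have "(u, v) \<in> E"
    using append_act_E[OF assms(1), of "[]"] append_act_E[OF assms(2), of "[]"]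
    by (auto intro: pres_cong.trans pres_cong.sym)
  then show "cls u = cls v" unfolding cls_def by (rule equiv_class_eq[OF equiv_E])
qed

lemma cls_act: "u \<in> lists A \<Longrightarrow> w \<in> lists A \<Longrightarrow> cls (act n u w) = cls (u @ w)"
  unfolding cls_def by (rule equiv_class_eq[OF equiv_E, symmetric]) (rule append_act_E)

lemma carrier_M: "carrier M = cls ` lists A"
  unfolding M_monoid_def cls_def by (rule presented_monoid_carrier[OF M_relations_subset])

lemma mult_cls: "u \<in> lists A \<Longrightarrow> v \<in> lists A \<Longrightarrow> cls u \<otimes>\<^bsub>M\<^esub> cls v = cls (u @ v)"
  unfolding M_monoid_def cls_def by (rule presented_monoid_mult_class[OF M_relations_subset])

lemma one_M: "\<one>\<^bsub>M\<^esub> = cls []"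
  by (simp add: M_monoid_def cls_def presented_monoid_def)

sublocale M: monoid M
  unfolding M_monoid_def by (rule monoid_presented_monoid[OF M_relations_subset])

lemma rk_cls:
  assumes w: "w \<in> lists A"
  shows "rk (cls w) = length w"
proof -
  have "w \<in> cls w" unfolding cls_def by (rule equiv_class_self[OF equiv_E w])
  then have "(w, SOME v. v \<in> cls w) \<in> E" using someI[of "\<lambda>v. v \<in> cls w"] unfolding cls_def by blast
  from arg_cong[OF act_cong[OF this, of "[]"], of length] show ?thesis
    by (simp add: rk_def)
qed

text \<open>Only the multiple has to be normalised, since the divisor enters through its action. All
  questions on divisibility in the monoid thus become questions on words.\<close>

lemma divides_cls_iff:
  assumes u: "u \<in> lists A" and v: "v \<in> lists A"
  shows "cls u divides\<^bsub>M\<^esub> cls v \<longleftrightarrow> ldiv n u (act n v [])"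
proof
  assume "cls u divides\<^bsub>M\<^esub> cls v"
  then obtain w where w: "w \<in> lists A" "cls v = cls u \<otimes>\<^bsub>M\<^esub> cls w"
    unfolding factor_def carrier_M by blast
  moreover have "u @ w \<in> lists A" using u w by simp
  ultimately have "act n v [] = act n u (act n w [])"
    using cls_eq_iff[OF v \<open>u @ w \<in> lists A\<close>] u by (simp add: mult_cls)
  then show "ldiv n u (act n v [])" unfolding ldiv_def ..
next
  assume "ldiv n u (act n v [])"
  then obtain w where w: "act n v [] = act n u w" unfolding ldiv_def ..
  have nv: "act n v [] \<in> lists A" using act_in_lists[OF one_in(1) v, of "[]"] by simp
  \<comment> \<open>The cofactor is a suffix of the normal form of \<open>v\<close>, so its letters
    are generators.\<close>
  then have wA: "w \<in> lists A"
    using w drop_act[of u n w] set_drop_subset[of "length u" "act n u w"] by (simp add: in_lists_conv_set subset_iff)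
  have "cls v = cls (act n v [])" using cls_act[OF v, of "[]"] by simp
  also have "\<dots> = cls u \<otimes>\<^bsub>M\<^esub> cls w" unfolding w using cls_act[OF u wA] mult_cls[OF u wA] by simp
  finally show "cls u divides\<^bsub>M\<^esub> cls v" using wA unfolding factor_def carrier_M by blast
qed

lemma divides_append: "u \<in> lists A \<Longrightarrow> w \<in> lists A \<Longrightarrow> cls u divides\<^bsub>M\<^esub> cls (u @ w)"
  unfolding factor_def carrier_M by (metis mult_cls image_eqI)

section \<open>Cancellation, common multiples and the divisibility order\<close>

lemma homogeneously_finitely_generated_M: "homogeneously_finitely_generated M"
  unfolding homogeneously_finitely_generated_def
proof (intro conjI exI)
  show "monoid M" ..
  show "finite A" by simp
  show "M_relations n r \<subseteq> lists A \<times> lists A" by (rule M_relations_subset)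
  show "\<forall>(w, w')\<in>M_relations n r. length w = length w'"
    using n by (auto simp: M_relations_iff)
  show "M \<cong> presented_monoid A (M_relations n r)" unfolding M_monoid_def by simp
qed

lemma left_cancellative_M: "left_cancellative M"
  unfolding left_cancellative_def carrier_M
proof (intro ballI impI)
  fix a b c assume "a \<in> cls ` lists A" "b \<in> cls ` lists A" "c \<in> cls ` lists A"
  then obtain u v w where *: "a = cls u" "b = cls v" "c = cls w"
    and A: "u \<in> lists A" "v \<in> lists A" "w \<in> lists A" by blast
  then have A': "u @ v \<in> lists A" "u @ w \<in> lists A" by simp_all
  assume "a \<otimes>\<^bsub>M\<^esub> b = a \<otimes>\<^bsub>M\<^esub> c"
  then have "act n u (act n v []) = act n u (act n w [])"
    using cls_eq_iff[OF A'] A * by (simp add: mult_cls)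
  then show "b = c" using act_inject cls_eq_iff[OF A(2,3)] * by blast
qed

lemma ex_least_common_right_multiple:
  assumes "a \<in> carrier M" "b \<in> carrier M"
  shows "\<exists>c. is_least_common_right_multiple M c a b"
proof -
  obtain u v where uv: "u \<in> lists A" "v \<in> lists A" "a = cls u" "b = cls v"
    using assms unfolding carrier_M by blast
  obtain c where c: "c \<in> lists A" "\<And>d. ldiv n c d \<longleftrightarrow> ldiv n u d \<and> ldiv n v d"
    using ex_lcm[OF one_in(1) uv(1,2), of n] by blast
  have "cls c divides\<^bsub>M\<^esub> d \<longleftrightarrow> a divides\<^bsub>M\<^esub> d \<and> b divides\<^bsub>M\<^esub> d" if "d \<in> carrier M" for d
  proof -
    obtain w where w: "w \<in> lists A" "d = cls w" using \<open>d \<in> carrier M\<close> unfolding carrier_M by blast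
    show ?thesis unfolding w(2) uv(3,4) using c(2) divides_cls_iff[OF _ w(1)] uv(1,2) c(1) by metis
  qed
  moreover have "cls c \<in> carrier M" using c(1) unfolding carrier_M by blast
  \<comment> \<open>The equivalence at \<open>d = cls c\<close> shows that \<open>cls c\<close> is a
    common multiple; at other \<open>d\<close> it gives minimality.\<close>
  ultimately have "is_least_common_right_multiple M (cls c) a b"
    unfolding is_least_common_right_multiple_def by (metis M.divides_refl)
  then show ?thesis ..
qed

text \<open>Lengths add under multiplication, so a product equal to the unit has factors of length
  0.\<close>

lemma partial_order_P: "partial_order P"
proof (rule M.partial_order_left_divisibility[OF left_cancellative_M])
  fix x y assume "x \<in> carrier M" "y \<in> carrier M" and xy: "x \<otimes>\<^bsub>M\<^esub> y = \<one>\<^bsub>M\<^esub>"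
  then obtain u v where uv: "u \<in> lists A" "v \<in> lists A" "x = cls u" "y = cls v"
    unfolding carrier_M by blast
  then have "rk (cls (u @ v)) = rk (cls [])" using xy by (simp add: mult_cls one_M)
  moreover have "u @ v \<in> lists A" using uv by simp
  ultimately have "length (u @ v) = length ([] :: nat list)" using rk_cls by (metis lists.Nil)
  then show "x = \<one>\<^bsub>M\<^esub>" using uv by (simp add: one_M)
qed

text \<open>The cofactor is nonempty; splitting off its first letter \<open>i\<close> prepares the
  step from \<open>u\<close> to \<open>u @ [i]\<close> of rank one.\<close>

lemma strict_dividesE:
  assumes "x \<in> carrier M" "y \<in> carrier M" "x \<sqsubset>\<^bsub>P\<^esub> y"
  obtains u i w where "u \<in> lists A" "i \<in> A" "w \<in> lists A" "x = cls u" "y = cls (u @ i # w)"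
proof -
  obtain u where u: "u \<in> lists A" "x = cls u" using assms(1) unfolding carrier_M by blast
  have "x divides\<^bsub>M\<^esub> y" using assms(3) by simp
  then obtain w where w: "w \<in> lists A" "y = x \<otimes>\<^bsub>M\<^esub> cls w"
    unfolding factor_def carrier_M by blast
  then have y: "y = cls (u @ w)" using u by (simp add: mult_cls)
  then have "w \<noteq> []" using assms(3) u by auto
  then show thesis using that u w(1) y by (cases w) auto
qed

sublocale P: graded_poset P rk "cls []"
proof -
  interpret partial_order P by (rule partial_order_P)
  show "graded_poset P rk (cls [])"
  proof unfold_locales
    show "least P (cls []) (carrier P)"
      using divides_append[of "[]"] by (auto simp: least_def carrier_M)
    show "rk (cls []) = 0" by (simp add: rk_cls)
  next
    fix x y assume "x \<in> carrier P" "y \<in> carrier P" "x \<sqsubset>\<^bsub>P\<^esub> y"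
    then obtain u i w where uiw: "u \<in> lists A" "i \<in> A" "w \<in> lists A" "x = cls u" "y = cls (u @ i # w)"
      using strict_dividesE unfolding left_divisibility_order_simps by blast
    have A: "u @ i # w \<in> lists A" "u @ [i] \<in> lists A" "(u @ [i]) @ w \<in> lists A" "[i] \<in> lists A" using uiw by auto
    show "rk x < rk y" unfolding uiw(4,5) using rk_cls[OF uiw(1)] rk_cls[OF A(1)] by simp
    show "\<exists>z\<in>carrier P. x \<sqsubset>\<^bsub>P\<^esub> z \<and> z \<sqsubseteq>\<^bsub>P\<^esub> y \<and> rk z = Suc (rk x)"
    proof (intro bexI conjI)
      show rk: "rk (cls (u @ [i])) = Suc (rk x)"
        unfolding uiw(4) using rk_cls[OF uiw(1)] rk_cls[OF A(2)] by simp
      show "cls (u @ [i]) \<in> carrier P" using A(2) unfolding left_divisibility_order_simps carrier_M by blast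
      show "cls (u @ [i]) \<sqsubseteq>\<^bsub>P\<^esub> y"
        unfolding left_divisibility_order_simps uiw(5)
        using divides_append[OF A(2) uiw(3)] by simp
      have "x divides\<^bsub>M\<^esub> cls (u @ [i])"
        unfolding uiw(4) by (rule divides_append[OF uiw(1) A(4)])
      moreover have "x \<noteq> cls (u @ [i])" using rk by (metis n_not_Suc_n)
      ultimately show "x \<sqsubset>\<^bsub>P\<^esub> cls (u @ [i])" by simp
    qed
  qed
qed

lemma ex_strict_multiple: "x \<in> carrier P \<Longrightarrow> \<exists>y\<in>carrier P. x \<sqsubset>\<^bsub>P\<^esub> y"
proof -
  assume "x \<in> carrier P"
  then obtain u where u: "u \<in> lists A" "x = cls u"
    unfolding left_divisibility_order_simps carrier_M by blast
  have A: "u @ [1] \<in> lists A" "[1] \<in> lists A" using u r by auto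
  have "x divides\<^bsub>M\<^esub> cls (u @ [1])"
    unfolding u(2) by (rule divides_append[OF u(1) A(2)])
  moreover have "x \<noteq> cls (u @ [1])"
    using rk_cls[OF u(1)] rk_cls[OF A(1)] u(2) by auto
  ultimately have "x \<sqsubset>\<^bsub>P\<^esub> cls (u @ [1])" by simp
  moreover have "cls (u @ [1]) \<in> carrier P"
    using A(1) unfolding left_divisibility_order_simps carrier_M by blast
  ultimately show ?thesis by blast
qed

lemma finite_rank: "finite {p \<in> carrier P. rk p = k}"
proof (rule finite_subset)
  show "{p \<in> carrier P. rk p = k} \<subseteq> cls ` {w. set w \<subseteq> A \<and> length w = k}"
    by (auto simp: carrier_M in_lists_conv_set rk_cls)
  show "finite (cls ` {w. set w \<subseteq> A \<and> length w = k})"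
    by (intro finite_imageI finite_lists_length_eq) simp
qed

lemma lattice_P: "lattice P"
proof (rule P.lattice_if_joins)
  fix x y assume xy: "x \<in> carrier P" "y \<in> carrier P"
  then obtain c where "is_least_common_right_multiple M c x y"
    using ex_least_common_right_multiple by auto
  then have "least P c (Upper P {x, y})"
    using xy unfolding is_least_common_right_multiple_def least_def Upper_def by auto
  then show "\<exists>s. least P s (Upper P {x, y})" ..
qed

lemma upho_lattice_P: "upho_lattice P"
  unfolding upho_lattice_def
proof (intro conjI ballI)
  show "lattice P" by (rule lattice_P)
  show "finite_type_N_graded P" using ex_strict_multiple finite_rank by (rule P.finite_type_N_gradedI)
  have "cls [] \<in> carrier P" by (rule P.b_least(1))
  then show "\<exists>x\<in>carrier P. \<exists>y\<in>carrier P. x \<noteq> y" using ex_strict_multiple by fastforce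
  show "poset_isomorphic (principal_filter P p) P" if "p \<in> carrier P" for p
    using that by (intro M.principal_filter_left_divisibility left_cancellative_M) simp
qed

end


section \<open>The finite lattice\<close>

lemma poset_isomorphic_sym:
  assumes "poset_isomorphic X Y"
  shows "poset_isomorphic Y X"
proof -
  obtain f where f: "bij_betw f (carrier X) (carrier Y)"
    "\<And>x y. x \<in> carrier X \<Longrightarrow> y \<in> carrier X \<Longrightarrow> x \<sqsubseteq>\<^bsub>X\<^esub> y \<longleftrightarrow> f x \<sqsubseteq>\<^bsub>Y\<^esub> f y"
    using assms unfolding poset_isomorphic_def by blast
  let ?g = "inv_into (carrier X) f"
  have "u \<sqsubseteq>\<^bsub>Y\<^esub> v \<longleftrightarrow> ?g u \<sqsubseteq>\<^bsub>X\<^esub> ?g v" if "u \<in> carrier Y" "v \<in> carrier Y" for u v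
    using that f(2)[of "?g u" "?g v"] bij_betw_apply[OF bij_betw_inv_into[OF f(1)]]
      bij_betw_inv_into_right[OF f(1)] by simp
  with bij_betw_inv_into[OF f(1)] show ?thesis unfolding poset_isomorphic_def by blast
qed

fun L_rank :: "nat \<Rightarrow> (nat \<times> nat) with_bounds \<Rightarrow> nat" where
  "L_rank n Minimum = 0"
| "L_rank n (Inner (i, a)) = a"
| "L_rank n Maximum = n"

lemma carrier_L:
  "carrier (L_lattice n r) = insert Minimum (insert Maximum (Inner ` ({1..r} \<times> {1..n - 1})))"
  by (simp add: L_lattice_def adjoin_bounds_def disjoint_chains_def)

lemma le_L: "x \<sqsubseteq>\<^bsub>L_lattice n r\<^esub> y \<longleftrightarrow> with_bounds_le (\<lambda>(i, a) (j, b). i = j \<and> a \<le> b) x y"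
  by (simp add: L_lattice_def adjoin_bounds_def disjoint_chains_def)

lemma eq_L [simp]: "x .=\<^bsub>L_lattice n r\<^esub> y \<longleftrightarrow> x = y"
  by (simp add: L_lattice_def adjoin_bounds_def)

lemma le_L_simps [simp]:
  "Minimum \<sqsubseteq>\<^bsub>L_lattice n r\<^esub> y"
  "x \<sqsubseteq>\<^bsub>L_lattice n r\<^esub> Maximum"
  "\<not> Inner p \<sqsubseteq>\<^bsub>L_lattice n r\<^esub> Minimum"
  "\<not> Maximum \<sqsubseteq>\<^bsub>L_lattice n r\<^esub> Minimum"
  "\<not> Maximum \<sqsubseteq>\<^bsub>L_lattice n r\<^esub> Inner p"
  "Inner (i, a) \<sqsubseteq>\<^bsub>L_lattice n r\<^esub> Inner (j, b) \<longleftrightarrow> i = j \<and> a \<le> b"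
proof -
  show "x \<sqsubseteq>\<^bsub>L_lattice n r\<^esub> Maximum" by (cases x) (simp_all add: le_L)
qed (simp_all add: le_L)

lemma carrier_L_cases [consumes 1, case_names Minimum Maximum Inner]:
  assumes "x \<in> carrier (L_lattice n r)"
  obtains "x = Minimum" | "x = Maximum"
  | i a where "x = Inner (i, a)" "1 \<le> i" "i \<le> r" "1 \<le> a" "a \<le> n - 1"
  using assms by (auto simp: carrier_L)

lemma partial_order_L: "partial_order (L_lattice n r)"
proof
  fix x y assume "x \<in> carrier (L_lattice n r)" "y \<in> carrier (L_lattice n r)"
    "x \<sqsubseteq>\<^bsub>L_lattice n r\<^esub> y" "y \<sqsubseteq>\<^bsub>L_lattice n r\<^esub> x"
  then show "x .=\<^bsub>L_lattice n r\<^esub> y"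
    by (elim carrier_L_cases) auto
next
  fix x y z assume "x \<sqsubseteq>\<^bsub>L_lattice n r\<^esub> y" "y \<sqsubseteq>\<^bsub>L_lattice n r\<^esub> z"
    "x \<in> carrier (L_lattice n r)" "y \<in> carrier (L_lattice n r)" "z \<in> carrier (L_lattice n r)"
  then show "x \<sqsubseteq>\<^bsub>L_lattice n r\<^esub> z"
    by (elim carrier_L_cases) auto
next
  fix x assume "x \<in> carrier (L_lattice n r)"
  then show "x \<sqsubseteq>\<^bsub>L_lattice n r\<^esub> x"
    by (elim carrier_L_cases) auto
qed (auto simp: fun_eq_iff)

lemma less_L: "x \<sqsubset>\<^bsub>L_lattice n r\<^esub> y \<longleftrightarrow> x \<sqsubseteq>\<^bsub>L_lattice n r\<^esub> y \<and> x \<noteq> y"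
  by (simp add: lless_def)

context chain_monoid
begin

abbreviation "L \<equiv> L_lattice n r"

lemma next_below_L:
  assumes "x \<in> carrier L" "y \<in> carrier L" "x \<sqsubset>\<^bsub>L\<^esub> y"
  shows "\<exists>z\<in>carrier L. x \<sqsubset>\<^bsub>L\<^esub> z \<and> z \<sqsubseteq>\<^bsub>L\<^esub> y \<and> L_rank n z = Suc (L_rank n x)"
  using assms(1)
proof (cases rule: carrier_L_cases)
  case Minimum
  from assms(2) show ?thesis
  proof (cases rule: carrier_L_cases)
    case Maximum
    \<comment> \<open>The chains are nonempty because \<open>n\<close> is at least 2, so an element
      of rank 1 lies between the bounds.\<close>
    then show ?thesis using \<open>x = Minimum\<close> n r
      by (intro bexI[of _ "Inner (1, 1)"]) (auto simp: less_L carrier_L)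
  next
    case (Inner i a)
    then show ?thesis using \<open>x = Minimum\<close>
      by (intro bexI[of _ "Inner (i, 1)"]) (auto simp: less_L carrier_L)
  qed (use assms Minimum in \<open>auto simp: less_L\<close>)
next
  case x: (Inner i a)
  from assms(2) show ?thesis
  proof (cases rule: carrier_L_cases)
    case Maximum
    show ?thesis
    proof (cases "a = n - 1")
      case True
      then show ?thesis using x Maximum n
        by (intro bexI[of _ Maximum]) (auto simp: less_L carrier_L)
    next
      case False
      then show ?thesis using x Maximum
        by (intro bexI[of _ "Inner (i, Suc a)"]) (auto simp: less_L carrier_L)
    qed
  next
    case (Inner j c)
    then show ?thesis using x assms(3)
      by (intro bexI[of _ "Inner (i, Suc a)"]) (auto simp: less_L carrier_L)
  qed (use assms x in \<open>auto simp: less_L\<close>)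
next
  case Maximum
  with assms show ?thesis by (auto simp: less_L elim: carrier_L_cases)
qed

sublocale L: graded_poset L "L_rank n" Minimum
proof -
  interpret partial_order L by (rule partial_order_L)
  show "graded_poset L (L_rank n) Minimum"
  proof unfold_locales
    show "least L Minimum (carrier L)" by (auto simp: least_def carrier_L)
    show "L_rank n x < L_rank n y" if "x \<in> carrier L" "y \<in> carrier L" "x \<sqsubset>\<^bsub>L\<^esub> y" for x y
      using that n by (elim carrier_L_cases) (auto simp: less_L)
  qed (simp_all add: next_below_L)
qed

lemma finite_graded_lattice_L: "finite_graded_lattice L"
  unfolding finite_graded_lattice_def
proof (intro conjI exI)
  show "lattice L"
  proof (rule L.lattice_if_joins)
    fix x y assume xy: "x \<in> carrier L" "y \<in> carrier L"
    consider "x \<sqsubseteq>\<^bsub>L\<^esub> y" | "y \<sqsubseteq>\<^bsub>L\<^esub> x" | "\<not> x \<sqsubseteq>\<^bsub>L\<^esub> y" "\<not> y \<sqsubseteq>\<^bsub>L\<^esub> x" by blast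
    then show "\<exists>s. least L s (Upper L {x, y})"
    proof cases
      case 1
      then have "least L y (Upper L {x, y})" using xy by (auto simp: least_def Upper_def)
      then show ?thesis ..
    next
      case 2
      then have "least L x (Upper L {x, y})" using xy by (auto simp: least_def Upper_def)
      then show ?thesis ..
    next
      case 3
      \<comment> \<open>Incomparable elements lie on different chains, so only the maximum is above
        both.\<close>
      have "z = Maximum" if "z \<in> carrier L" "x \<sqsubseteq>\<^bsub>L\<^esub> z" "y \<sqsubseteq>\<^bsub>L\<^esub> z" for z
        using that xy 3 by (elim carrier_L_cases) auto
      then have "z = Maximum" if "z \<in> Upper L {x, y}" for z
        using that xy by (simp add: Upper_def)
      then have "Upper L {x, y} \<subseteq> {Maximum}" by blast
      then have "least L Maximum (Upper L {x, y})"
        by (auto simp: least_def Upper_def carrier_L)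
      then show ?thesis ..
    qed
  qed
  show "finite (carrier L)" "carrier L \<noteq> {}" by (simp_all add: carrier_L)
  show "rank_function L (L_rank n)" by (rule L.rank_function)
qed

section \<open>Moebius function and characteristic polynomial\<close>

lemma finite_interval_L: "finite \<lbrace>x..y\<rbrace>\<^bsub>L\<^esub>"
  by (rule finite_subset[of _ "carrier L"]) (auto simp: at_least_at_most_def carrier_L)

lemma moebius_L_Minimum: "moebius L Minimum Minimum = 1"
  using L.b_least(1) finite_interval_L[of Minimum Minimum] partial_order_L[of n r]
  by (subst moebius.simps) simp

lemma moebius_L_eq:
  assumes "y \<in> carrier L" "y \<noteq> Minimum"
  shows "moebius L Minimum y = - (\<Sum>z\<in>\<lbrace>Minimum..y\<rbrace>\<^bsub>L\<^esub> - {y}. moebius L Minimum z)"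
  using assms L.b_least(1) finite_interval_L[of Minimum y] partial_order_L[of n r]
  by (subst moebius.simps) simp

text \<open>The interval below is a chain: for \<open>a = 1\<close> only the minimum contributes,
  and for larger \<open>a\<close> the values 1 and -1 of the first two elements cancel.\<close>

lemma moebius_L_Inner:
  assumes "1 \<le> i" "i \<le> r" "1 \<le> a" "a \<le> n - 1"
  shows "moebius L Minimum (Inner (i, a)) = (if a = 1 then - 1 else 0)"
  using assms(3,4)
proof (induction a rule: less_induct)
  case (less a)
  have "\<lbrace>Minimum..Inner (i, a)\<rbrace>\<^bsub>L\<^esub> - {Inner (i, a)} = insert Minimum ((\<lambda>c. Inner (i, c)) ` {1..<a})"
    using assms less.prems by (auto simp: at_least_at_most_def carrier_L)
  then have "moebius L Minimum (Inner (i, a)) = - (1 + (\<Sum>c\<in>{1..<a}. moebius L Minimum (Inner (i, c))))"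
    using assms less.prems by (subst moebius_L_eq)
      (auto simp: carrier_L sum.reindex inj_on_def moebius_L_Minimum image_iff)
  also have "(\<Sum>c\<in>{1..<a}. moebius L Minimum (Inner (i, c))) = (\<Sum>c\<in>{1..<a}. if c = 1 then - 1 else 0)"
    using less.prems by (intro sum.cong less.IH) auto
  finally show ?case using less.prems by (simp add: sum.delta)
qed

text \<open>With \<open>f\<close> arbitrary, one computation serves both the Moebius value of the
  maximum and the polynomial; terms with Moebius value 0 therefore remain as
  \<open>f 0 a\<close>.\<close>

lemma sum_carrier_L_Inner:
  "(\<Sum>p\<in>Inner ` (A \<times> {1..n - 1}). f (moebius L Minimum p) (L_rank n p))
    = of_nat r * (f (- 1) 1 + (\<Sum>a\<in>{2..n - 1}. f 0 a))"
  for f :: "int \<Rightarrow> nat \<Rightarrow> 'b :: comm_ring_1"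
proof -
  have "(\<Sum>p\<in>Inner ` (A \<times> {1..n - 1}). f (moebius L Minimum p) (L_rank n p))
      = (\<Sum>i\<in>A. \<Sum>a\<in>{1..n - 1}. f (moebius L Minimum (Inner (i, a))) a)"
    by (simp add: sum.reindex inj_on_def sum.cartesian_product case_prod_unfold)
      (rule sum.cong; auto)
  also have "\<dots> = (\<Sum>i\<in>A. \<Sum>a\<in>{1..n - 1}. f (if a = 1 then - 1 else 0) a)"
    by (intro sum.cong refl) (auto simp: moebius_L_Inner)
  also have "\<dots> = (\<Sum>i\<in>A. f (- 1) 1 + (\<Sum>a\<in>{2..n - 1}. f 0 a))"
  proof (intro sum.cong HOL.refl)
    have "{1..n - 1} = insert 1 {2..n - 1}" using n by auto
    then show "(\<Sum>a\<in>{1..n - 1}. f (if a = 1 then - 1 else 0) a) = f (- 1) 1 + (\<Sum>a\<in>{2..n - 1}. f 0 a)"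
      by (simp only:) (simp; rule sum.cong; simp)
  qed
  finally show ?thesis by simp
qed

lemma moebius_L_Maximum: "moebius L Minimum Maximum = int r - 1"
proof -
  have interval: "\<lbrace>Minimum..Maximum\<rbrace>\<^bsub>L\<^esub> - {Maximum} = insert Minimum (Inner ` (A \<times> {1..n - 1}))"
    by (auto simp: at_least_at_most_def carrier_L)
  have "Maximum \<in> carrier L" "(Maximum :: (nat \<times> nat) with_bounds) \<noteq> Minimum"
    by (simp_all add: carrier_L)
  from moebius_L_eq[OF this, unfolded interval]
  have "moebius L Minimum Maximum
      = - (1 + (\<Sum>p\<in>Inner ` (A \<times> {1..n - 1}). moebius L Minimum p))"
    by (subst (asm) sum.insert) (auto simp: moebius_L_Minimum)
  then show ?thesis using sum_carrier_L_Inner[of "\<lambda>m k. m"] by simp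
qed

lemma chi_star_L: "chi_star L = 1 - monom (of_nat r) 1 + monom (of_nat r - 1) n"
proof -
  have "chi_star L = (\<Sum>p\<in>carrier L. monom (of_int (moebius L Minimum p)) (L_rank n p))"
    unfolding chi_star_def L.bottom by (intro sum.cong HOL.refl) (simp add: L.rank_eq)
  also have "\<dots> = monom 1 0 + (monom (of_nat r - 1) n +
      (\<Sum>p\<in>Inner ` (A \<times> {1..n - 1}). monom (of_int (moebius L Minimum p)) (L_rank n p)))"
    unfolding carrier_L by (subst sum.insert; auto simp: moebius_L_Minimum moebius_L_Maximum)+
  also have "(\<Sum>p\<in>Inner ` (A \<times> {1..n - 1}). monom (of_int (moebius L Minimum p) :: rat) (L_rank n p))
      = - monom (of_nat r) 1"
    using sum_carrier_L_Inner[of "\<lambda>m k. monom (of_int m :: rat) k"]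
    by (simp add: of_nat_poly smult_monom flip: minus_monom)
  finally show ?thesis by (simp add: monom_0 one_pCons)
qed


section \<open>The core\<close>

text \<open>A normal form is divisible by all generators exactly if it starts with \<open>n\<close>
  letters 1.\<close>

lemma is_lub_atoms: "least P (cls (replicate n 1)) (Upper P (atoms P))"
proof -
  have n1: "replicate n 1 \<in> lists A" using r by auto
  have atom: "cls [i] \<in> atoms P" if "i \<in> A" for i
    using that rk_cls[of "[i]"] unfolding P.atoms_eq by (simp add: carrier_M)
  have iff: "(\<forall>x\<in>atoms P. x divides\<^bsub>M\<^esub> cls w) \<longleftrightarrow> cls (replicate n 1) divides\<^bsub>M\<^esub> cls w"
    if w: "w \<in> lists A" for w
  proof
    assume "\<forall>x\<in>atoms P. x divides\<^bsub>M\<^esub> cls w"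
    then have "cls [i] divides\<^bsub>M\<^esub> cls w" if "i \<in> A" for i using atom[OF that] by blast
    \<comment> \<open>Two distinct generators suffice to force the prefix, and \<open>r\<close> at
      least 2 provides them.\<close>
    then have "ldiv n [1] (act n w [])" "ldiv n [2] (act n w [])"
      using r w divides_cls_iff[of "[_]" w] by auto
    then have "ldiv n (1 # replicate (n - 1) 1) (act n w [])"
      using ldiv_Cons_Cons[of 1 2 n "[]" "act n w []" "[]"] by (auto simp: ldiv_Cons)
    then show "cls (replicate n 1) divides\<^bsub>M\<^esub> cls w"
      using divides_cls_iff[OF n1 w] by (simp add: replicate_n)
  next
    assume "cls (replicate n 1) divides\<^bsub>M\<^esub> cls w"
    then obtain v where "act n w [] = 1 # v" "ldiv n (replicate (n - 1) 1) v"
      using divides_cls_iff[OF n1 w] by (auto simp: replicate_n ldiv_Cons)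
    \<comment> \<open>In front of \<open>n - 1\<close> letters 1 every letter is rewritten to 1, so
      every generator divides.\<close>
    then have *: "ldiv n [i] (act n w [])" for i
      unfolding ldiv_replicate_one by (auto simp: ldiv_Cons head_def)
    show "\<forall>x\<in>atoms P. x divides\<^bsub>M\<^esub> cls w"
    proof
      fix x assume "x \<in> atoms P"
      then obtain u where "u \<in> lists A" "x = cls u" "rk x = 1"
        unfolding P.atoms_eq left_divisibility_order_simps carrier_M by blast
      then have u: "u \<in> lists A" "x = cls u" "length u = 1" using rk_cls[of u] by simp_all
      then obtain i where "u = [i]" by (auto simp: length_Suc_conv)
      then show "x divides\<^bsub>M\<^esub> cls w" using u(1,2) * divides_cls_iff[OF u(1) w] by simp
    qed
  qed
  have atoms: "atoms P \<subseteq> carrier M" unfolding P.atoms_eq by auto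
  have c: "cls (replicate n 1) \<in> carrier M" using n1 unfolding carrier_M by blast
  have U: "y \<in> Upper P (atoms P) \<longleftrightarrow> y \<in> carrier M \<and> cls (replicate n 1) divides\<^bsub>M\<^esub> y" for y
  proof (cases "y \<in> carrier M")
    case True
    then obtain w where w: "w \<in> lists A" "y = cls w" unfolding carrier_M by blast
    then show ?thesis
      using True iff[OF w(1)] atoms by (simp add: Upper_def Ball_def subset_iff) metis
  qed (simp add: Upper_def)
  show ?thesis
    using c M.divides_refl[OF c] by (simp add: least_def U) (simp add: Upper_def)
qed

lemma carrier_core: "carrier (core P) = {x \<in> carrier M. x divides\<^bsub>M\<^esub> cls (replicate n 1)}"
proof -
  have "\<Squnion>\<^bsub>P\<^esub>(atoms P) = cls (replicate n 1)"
    unfolding sup_def using is_lub_atoms by (rule some_equality) (rule P.least_unique[OF _ is_lub_atoms])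
  then show ?thesis
    using P.b_least unfolding core_def P.bottom by (auto simp: at_least_at_most_def)
qed

text \<open>Normal forms of the divisors of \<open>x_1^n\<close>. The \<open>a\<close>-th element of
  chain \<open>i\<close> is \<open>x_i x_1^(a-1)\<close>; it has length below \<open>n\<close>, so
  it cannot be rewritten. One more letter 1 at the top of any chain gives
  \<open>x_1^n\<close>.\<close>

fun L_word :: "(nat \<times> nat) with_bounds \<Rightarrow> nat list" where
  "L_word Minimum = []"
| "L_word (Inner (i, a)) = i # replicate (a - 1) 1"
| "L_word Maximum = replicate n 1"

lemma head_replicate: "k < n - 1 \<Longrightarrow> head n i (replicate k 1) = i"
  by (auto simp: head_def dest: arg_cong[of _ _ length])

lemma L_word_in_lists: "x \<in> carrier L \<Longrightarrow> L_word x \<in> lists A"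
  using r by (elim carrier_L_cases) auto

lemma L_word_normal: "x \<in> carrier L \<Longrightarrow> act n (L_word x) [] = L_word x"
  using head_replicate by (elim carrier_L_cases) auto

lemma ldiv_length: "ldiv n u d \<Longrightarrow> length u \<le> length d"
  by (auto simp: ldiv_def)

lemma ldiv_L_word_iff:
  assumes "x \<in> carrier L" "y \<in> carrier L"
  shows "ldiv n (L_word x) (L_word y) \<longleftrightarrow> x \<sqsubseteq>\<^bsub>L\<^esub> y"
  using assms(1)
proof (cases rule: carrier_L_cases)
  case Maximum
  then have "x \<sqsubseteq>\<^bsub>L\<^esub> y" if "ldiv n (L_word x) (L_word y)"
    using assms(2) ldiv_length[OF that] n by (elim carrier_L_cases) auto
  moreover have "ldiv n (L_word x) (L_word y)" if "x \<sqsubseteq>\<^bsub>L\<^esub> y"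
    using that Maximum assms(2) ldiv_replicate_one[of n n "replicate n 1"]
    by (elim carrier_L_cases) auto
  ultimately show ?thesis by blast
next
  case x: (Inner i a)
  from assms(2) show ?thesis
  proof (cases rule: carrier_L_cases)
    case Maximum
    have "ldiv n (replicate (a - 1) 1) (replicate (n - 1) 1)"
      using x unfolding ldiv_replicate_one by (simp add: min_def)
    then show ?thesis using x Maximum head_replicate_append[of n "n - 1" i "[]"]
      by (simp add: replicate_n ldiv_Cons)
  next
    case (Inner j c)
    then have "ldiv n (replicate (a - 1) 1) (replicate (c - 1) 1) \<longleftrightarrow> a \<le> c"
      using x unfolding ldiv_replicate_one by (auto simp: min_def dest: arg_cong[of _ _ length])
    then show ?thesis using x Inner head_replicate[of "c - 1" i] by (auto simp: ldiv_Cons)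
  qed (use x in \<open>simp add: ldiv_Cons\<close>)
qed simp

text \<open>The first letter of \<open>u\<close> is arbitrary, but the rest divides
  \<open>x_1^(n-1)\<close> and so is a power of \<open>x_1\<close>. Full length makes
  \<open>u\<close> collapse to \<open>x_1^n\<close>, the maximum, whatever its first letter.\<close>

lemma ldiv_replicate_n:
  assumes u: "u \<in> lists A" and div: "ldiv n u (replicate n 1)"
  shows "\<exists>x\<in>carrier L. act n u [] = L_word x"
proof (cases u)
  case Nil
  then show ?thesis by (intro bexI[of _ Minimum]) (auto simp: carrier_L)
next
  case (Cons i w)
  then have "ldiv n w (replicate (n - 1) 1)"
    using div by (auto simp: replicate_n ldiv_Cons)
  then obtain m where m: "w = replicate m 1" "m \<le> n - 1"
    using ldiv_replicate_oneD ldiv_length by fastforce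
  show ?thesis
  proof (cases "m = n - 1")
    case True
    then have "act n u [] = L_word Maximum"
      using Cons m head_replicate_append[of n "n - 1" i "[]"] by (simp add: replicate_n)
    then show ?thesis by (intro bexI[of _ Maximum]) (auto simp: carrier_L)
  next
    case False
    then have "act n u [] = L_word (Inner (i, Suc m))"
      using Cons m head_replicate[of m i] by simp
    then show ?thesis using Cons u m False
      by (intro bexI[of _ "Inner (i, Suc m)"]) (auto simp: carrier_L)
  qed
qed

text \<open>The map is explicit from \<open>L\<close> to the core, so the isomorphism is built in
  that direction and reversed. Injectivity follows from order reflection and antisymmetry.\<close>

lemma core_isomorphic_L: "poset_isomorphic (core P) L"
proof (rule poset_isomorphic_sym)
  let ?f = "\<lambda>x. cls (L_word x)"
  have le: "?f x divides\<^bsub>M\<^esub> ?f y \<longleftrightarrow> x \<sqsubseteq>\<^bsub>L\<^esub> y" if "x \<in> carrier L" "y \<in> carrier L" for x y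
    using divides_cls_iff[OF L_word_in_lists[OF that(1)] L_word_in_lists[OF that(2)]]
      L_word_normal[OF that(2)] ldiv_L_word_iff[OF that] by simp
  have "inj_on ?f (carrier L)"
  proof (rule inj_onI)
    fix x y assume xy: "x \<in> carrier L" "y \<in> carrier L" "?f x = ?f y"
    have "?f x \<in> carrier M" using L_word_in_lists[OF xy(1)] unfolding carrier_M by blast
    then have "?f x divides\<^bsub>M\<^esub> ?f x" by (rule M.divides_refl)
    then have "x \<sqsubseteq>\<^bsub>L\<^esub> y" "y \<sqsubseteq>\<^bsub>L\<^esub> x" using le[OF xy(1,2)] le[OF xy(2,1)] xy(3) by simp_all
    then show "x = y" using L.le_antisym xy(1,2) by blast
  qed
  moreover have "?f ` carrier L = carrier (core P)"
  proof (intro equalityI subsetI)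
    fix X assume "X \<in> ?f ` carrier L"
    then obtain x where x: "x \<in> carrier L" "X = ?f x" by blast
    have "Maximum \<in> carrier L" by (simp add: carrier_L)
    then show "X \<in> carrier (core P)"
      using le[OF x(1)] x L_word_in_lists[OF x(1)] unfolding carrier_core carrier_M by force
  next
    fix X assume "X \<in> carrier (core P)"
    then obtain u where u: "u \<in> lists A" "X = cls u" "cls u divides\<^bsub>M\<^esub> cls (replicate n 1)"
      unfolding carrier_core carrier_M by blast
    have n1: "replicate n 1 \<in> lists A" using r by auto
    have "ldiv n u (replicate n 1)" using u divides_cls_iff[OF u(1) n1] by simp
    then obtain x where x: "x \<in> carrier L" "act n u [] = L_word x"
      using ldiv_replicate_n[OF u(1)] by blast
    then have "X = ?f x" using u(2) cls_act[OF u(1), of "[]"] by simp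
    then show "X \<in> ?f ` carrier L" using x(1) by blast
  qed
  moreover have "X \<sqsubseteq>\<^bsub>core P\<^esub> Y \<longleftrightarrow> X divides\<^bsub>M\<^esub> Y" for X Y
    by (simp add: core_def left_divisibility_order_def)
  ultimately show "poset_isomorphic L (core P)"
    unfolding poset_isomorphic_def bij_betw_def using le by (intro exI[of _ ?f]) simp
qed


section \<open>The rank generating function\<close>

definition normal_words :: "nat \<Rightarrow> nat list set" where
  "normal_words k = {w. set w \<subseteq> A \<and> length w = k \<and> act n w [] = w}"

lemma finite_normal_words: "finite (normal_words k)"
  by (rule finite_subset[OF _ finite_lists_length_eq[of A k]]) (auto simp: normal_words_def)

lemma card_rank: "card {p \<in> carrier P. rank P p = k} = card (normal_words k)"
proof -
  have "{p \<in> carrier P. rank P p = k} = cls ` normal_words k"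
  proof (intro equalityI subsetI)
    fix p assume "p \<in> {p \<in> carrier P. rank P p = k}"
    then obtain u where u: "u \<in> lists A" "p = cls u" "length u = k"
      using P.rank_eq[of p] by (auto simp: carrier_M rk_cls)
    have "act n u [] \<in> lists A" by (rule act_in_lists[OF one_in(1) u(1)]) simp
    moreover have "cls (act n u []) = p" using cls_act[OF u(1), of "[]"] u(2) by simp
    \<comment> \<open>Normalisation is idempotent because a word is congruent to its normal
      form.\<close>
    moreover have "act n (act n u []) [] = act n u []"
      using act_cong[OF append_act_E[OF u(1), of "[]"], of "[]"] by simp
    ultimately have "act n u [] \<in> normal_words k" using u(3) by (auto simp: normal_words_def in_lists_conv_set)
    then show "p \<in> cls ` normal_words k" using \<open>cls (act n u []) = p\<close> by blast
  next
    fix p assume "p \<in> cls ` normal_words k"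
    then obtain w where "w \<in> normal_words k" and p: "p = cls w" by blast
    then have w: "w \<in> lists A" "length w = k" "p = cls w" by (auto simp: normal_words_def in_lists_conv_set)
    then have "p \<in> carrier P" unfolding left_divisibility_order_simps carrier_M by blast
    then show "p \<in> {p \<in> carrier P. rank P p = k}" using P.rank_eq[of p] w rk_cls[OF w(1)] by simp
  qed
  moreover have "inj_on cls (normal_words k)"
  proof (rule inj_onI)
    fix u v assume uv: "u \<in> normal_words k" "v \<in> normal_words k" "cls u = cls v"
    then have "u \<in> lists A" "v \<in> lists A" by (auto simp: normal_words_def in_lists_conv_set)
    from cls_eq_iff[OF this] uv show "u = v" by (simp add: normal_words_def)
  qed
  ultimately show ?thesis by (simp add: card_image)
qed

lemma Cons_normal_words_iff:
  "i # w \<in> normal_words (Suc k) \<longleftrightarrow> i \<in> A \<and> w \<in> normal_words k \<and> head n i w = i"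
  by (auto simp: normal_words_def)

lemma normal_words_0: "normal_words 0 = {[]}"
  by (auto simp: normal_words_def)

text \<open>Every normal word \<open>v\<close> extends to the left by \<open>x\<^sub>1\<close>, and by the other generators unless \<open>v\<close>
  starts with \<open>x\<^sub>1\<^sup>n\<^sup>-\<^sup>1\<close>; in the latter case the rest of \<open>v\<close> is an arbitrary normal word.\<close>

lemma card_normal_words_Suc:
  "card (normal_words (Suc k)) + (r - 1) * (if n \<le> Suc k then card (normal_words (Suc k - n)) else 0)
    = r * card (normal_words k)"
proof -
  define S where "S = {v \<in> normal_words k. take (n - 1) v = replicate (n - 1) 1}"
  have S: "finite S" "S \<subseteq> normal_words k" unfolding S_def using finite_normal_words by auto
  have cardS: "card S = (if n \<le> Suc k then card (normal_words (Suc k - n)) else 0)"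
  proof (cases "n \<le> Suc k")
    case True
    \<comment> \<open>Letters 1 are never changed, so prefixing them to a normal word keeps it
      normal. The remaining length \<open>k - (n - 1)\<close> equals
      \<open>Suc k - n\<close>.\<close>
    have "S = (@) (replicate (n - 1) 1) ` normal_words (Suc k - n)"
    proof (intro equalityI subsetI)
      fix v assume v: "v \<in> S"
      then have eq: "v = replicate (n - 1) 1 @ drop (n - 1) v"
        unfolding S_def using append_take_drop_id[of "n - 1" v] by simp
      have "act n v [] = v" using v by (simp add: S_def normal_words_def)
      then have "replicate (n - 1) 1 @ act n (drop (n - 1) v) [] = replicate (n - 1) 1 @ drop (n - 1) v"
        by (subst (asm) (1 2) eq) simp
      then have "drop (n - 1) v \<in> normal_words (Suc k - n)"
        using v n True set_drop_subset[of "n - 1" v] by (auto simp: S_def normal_words_def)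
      then show "v \<in> (@) (replicate (n - 1) 1) ` normal_words (Suc k - n)" using eq by blast
    next
      fix v assume "v \<in> (@) (replicate (n - 1) 1) ` normal_words (Suc k - n)"
      then show "v \<in> S" using n r True by (auto simp: S_def normal_words_def subset_iff)
    qed
    then show ?thesis using True by (simp add: card_image inj_on_def)
  next
    case False
    then have "S = {}" by (auto simp: S_def normal_words_def dest: arg_cong[of _ _ length])
    then show ?thesis using False by simp
  qed
  have "normal_words (Suc k) = case_prod Cons ` (A \<times> (normal_words k - S) \<union> {1} \<times> S)"
  proof (intro equalityI subsetI)
    fix w assume w: "w \<in> normal_words (Suc k)"
    then obtain i v where "w = i # v" by (auto simp: normal_words_def length_Suc_conv)
    then show "w \<in> case_prod Cons ` (A \<times> (normal_words k - S) \<union> {1} \<times> S)"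
      using w by (auto simp: Cons_normal_words_iff S_def head_def split: if_splits)
  next
    fix w assume "w \<in> case_prod Cons ` (A \<times> (normal_words k - S) \<union> {1} \<times> S)"
    then show "w \<in> normal_words (Suc k)" using r by (auto simp: Cons_normal_words_iff S_def head_def split: if_splits)
  qed
  moreover have "inj_on (case_prod Cons) X" for X :: "(nat \<times> nat list) set"
    by (auto simp: inj_on_def)
  ultimately have "card (normal_words (Suc k)) = card (A \<times> (normal_words k - S) \<union> {1} \<times> S)"
    by (simp add: card_image)
  also have "\<dots> = r * (card (normal_words k) - card S) + card S"
    using finite_normal_words S by (subst card_Un_disjoint) (auto simp: card_Diff_subset)
  moreover have "card S \<le> card (normal_words k)" using S finite_normal_words by (intro card_mono)
  \<comment> \<open>Adding the \<open>r - 1\<close> extensions that each word of \<open>S\<close>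
    lacks makes every normal word of length \<open>k\<close> count \<open>r\<close> times.\<close>
  ultimately have "card (normal_words (Suc k)) + (r - 1) * card S = r * (card (normal_words k) - card S) + r * card S"
    using r by (cases r) simp_all
  also have "\<dots> = r * card (normal_words k)"
    using \<open>card S \<le> card (normal_words k)\<close> by (simp flip: distrib_left)
  finally show ?thesis unfolding cardS .
qed

text \<open>The coefficient of degree \<open>Suc k\<close> vanishes by the recursion for normal
  words, and the constant one counts the empty word.\<close>

lemma rank_gf_mult_chi_star: "rank_gf P * fps_of_poly (chi_star L) = 1"
proof (rule fps_ext)
  fix m
  define N where "N k = (of_nat (card (normal_words k)) :: rat)" for k
  have F: "rank_gf P = Abs_fps N" unfolding rank_gf_def card_rank N_def ..
  have chi: "fps_of_poly (chi_star L) = 1 - fps_const (of_nat r) * fps_X + fps_const (of_nat r - 1) * fps_X ^ n"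
    by (simp add: chi_star_L fps_of_poly_add fps_of_poly_diff fps_of_poly_monom)
  have "rank_gf P * fps_of_poly (chi_star L)
      = Abs_fps N - fps_const (of_nat r) * (Abs_fps N * fps_X) + fps_const (of_nat r - 1) * (Abs_fps N * fps_X ^ n)"
    unfolding F chi by (simp add: algebra_simps)
  then have nth: "fps_nth (rank_gf P * fps_of_poly (chi_star L)) m = N m - of_nat r * (if m = 0 then 0 else N (m - 1))
      + (of_nat r - 1) * (if m < n then 0 else N (m - n))"
    by (simp add: fps_X_power_mult_right_nth)
  show "fps_nth (rank_gf P * fps_of_poly (chi_star L)) m = fps_nth 1 m"
  proof (cases m)
    case 0
    then show ?thesis unfolding nth unfolding 0 using n by (simp add: N_def normal_words_0)
  next
    case (Suc k)
    have "N (Suc k) + (of_nat r - 1) * (if n \<le> Suc k then N (Suc k - n) else 0) = of_nat r * N k"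
      using arg_cong[OF card_normal_words_Suc[of k], of "of_nat :: nat \<Rightarrow> rat"] r
      by (simp add: N_def of_nat_diff split: if_splits)
    then show ?thesis unfolding nth unfolding Suc by (auto simp: algebra_simps split: if_splits)
  qed
qed

end

theorem theorem4p6:
  fixes n r :: nat
  assumes "n \<ge> 2" and "r \<ge> 2"
  shows "homogeneously_finitely_generated (M_monoid n r)
    \<and> left_cancellative (M_monoid n r)
    \<and> (\<forall>a\<in>carrier (M_monoid n r). \<forall>b\<in>carrier (M_monoid n r).
         \<exists>c. is_least_common_right_multiple (M_monoid n r) c a b)
    \<and> upho_lattice (left_divisibility_order (M_monoid n r))
    \<and> finite_graded_lattice (L_lattice n r)
    \<and> poset_isomorphic (core (left_divisibility_order (M_monoid n r))) (L_lattice n r)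
    \<and> inverse (rank_gf (left_divisibility_order (M_monoid n r)))
        = fps_of_poly (chi_star (L_lattice n r))
    \<and> chi_star (L_lattice n r) = 1 - monom (of_nat r) 1 + monom (of_nat r - 1) n"
proof -
  interpret chain_monoid n r using assms by unfold_locales
  show ?thesis
    using homogeneously_finitely_generated_M left_cancellative_M ex_least_common_right_multiple
      upho_lattice_P finite_graded_lattice_L core_isomorphic_L
      fps_inverse_unique[OF rank_gf_mult_chi_star] chi_star_L
    by blast
qed

end
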